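(* Let $C$ be the modular tensor category of a $2+1$D TQFT. For every $q\in\mathrm{Gal}(K_C)$, $C$ and its Galois conjugate $q(C)$ have isomorphic groups of 0-form unitary symmetries.
   Context: A modular tensor category (MTC) $C$ (simple objects $a,b,\dots$ called anyons, unit $\mathbf 1$, fusion rules $a\otimes b=\sum_c N_{ab}^c c$) is described, after choosing bases $|a,b,c;\mu\rangle$ of the fusion spaces $V_{ab}^c$ (such a choice is called a gauge), by its $F$ symbols $(F_{abc}^d)_{(e,\alpha,\beta)}^{(f,\mu,\nu)}$ ($e\in a\otimes b$, $f\in b\otimes c$), $R$ symbols $(R_{ab}^c)_{\mu\nu}$ and pivotal coefficients $\epsilon_a\in\{\pm1\}$. There is always a gauge in which all entries of $F$ and $R$ lie in a number field; fix such a gauge; $K_C$ is the normal closure over $\mathbb{Q}$ of $\mathbb{Q}(F,R)$. For $q\in\mathrm{Gal}(K_C):=\mathrm{Gal}(K_C/\mathbb{Q})$, $q(C)$ is the MTC with the same anyons, fusion rules and $\epsilon_a$, and with data $q(F),q(R)$. A unitary 0-form symmetry $g$ of $C$ consists of a permutation $a\mapsto g(a)$ of the anyons preserving fusion rules together with unitary matrices $U_g(a,b,c)$ acting on fusion spaces by $g|a,b,c;\mu\rangle=\sum_{\mu'}U_g(g(a),g(b),g(c))_{\mu\mu'}|g(a),g(b),g(c);\mu'\rangle$ such that $$\sum_{\mu',\nu'}[U_g(g(b),g(a),g(c))]_{\mu\mu'}(R^{g(c)}_{g(a)g(b)})_{\mu'\nu'}[U_g(g(a),g(b),g(c))^{-1}]_{\nu'\nu}=(R_{ab}^c)_{\mu\nu},$$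 $$\sum_{\alpha',\beta',\mu',\nu'}[U_g(g(a),g(b),g(e))]_{\alpha\alpha'}[U_g(g(e),g(c),g(d))]_{\beta\beta'}(F^{g(d)}_{g(a)g(b)g(c)})^{(g(f),\mu',\nu')}_{(g(e),\alpha',\beta')}[U_g(g(b),g(c),g(f))^{-1}]_{\mu'\mu}[U_g(g(a),g(f),g(d))^{-1}]_{\nu'\nu}=(F^d_{abc})^{(f,\mu,\nu)}_{(e,\alpha,\beta)}.$$ A natural isomorphism is a map fixing all anyons and acting as $|a,b,c;\mu\rangle\mapsto\frac{\gamma_a\gamma_b}{\gamma_c}|a,b,c;\mu\rangle$ for some phases $\gamma_a$. The group of unitary 0-form symmetries is the group of such maps $g$ modulo natural isomorphisms.
   Formalization: In an arbitrary fixed gauge the claim fails (rescaled toric code), so unitary groups are compared only in gauges of C and q(C) where every symmetry is unitary up to natural isomorphism; the groups with invertible U_g and nonzero γ_a are shown isomorphic unconditionally. *)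

theory Defs
  imports
    "HOL-Analysis.Analysis"
    "HOL-Algebra.Algebra"
    "HOL-Algebra.Algebraic_Closure_Type"
    "Jordan_Normal_Form.Gauss_Jordan_Elimination"
    "Jordan_Normal_Form.Schur_Decomposition"
begin

section \<open>Modular tensor categories presented by F and R symbols\<close>

text \<open>
  The (finitely many) anyons are the elements of a finite type.  The basis vectors
  $|a,b,c;\mu\rangle$ of $V_{ab}^c$ are numbered by $\mu < N_{ab}^c$, and
  \<open>Fsym C a b c d (e,\<alpha>,\<beta>) (f,\<mu>,\<nu>)\<close> is $(F_{abc}^d)_{(e,\alpha,\beta)}^{(f,\mu,\nu)}$, i.e.
  \[ |a,b,e;\alpha\rangle\,|e,c,d;\beta\rangle = \sum_{f,\mu,\nu}
       (F_{abc}^d)_{(e,\alpha,\beta)}^{(f,\mu,\nu)}\; |b,c,f;\mu\rangle\,|a,f,d;\nu\rangle . \]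
  The rows of \<open>Rsym C a b c\<close>, i.e. $R_{ab}^c$, are indexed by the basis of $V_{ba}^c$ and its
  columns by the basis of $V_{ab}^c$.  Values of \<open>Fsym\<close> outside the index ranges are junk and
  are never used.
\<close>

record 'a mtc_data =
  vac  :: 'a
  fus  :: "'a \<Rightarrow> 'a \<Rightarrow> 'a \<Rightarrow> nat"
  Fsym :: "'a \<Rightarrow> 'a \<Rightarrow> 'a \<Rightarrow> 'a \<Rightarrow> 'a \<times> nat \<times> nat \<Rightarrow> 'a \<times> nat \<times> nat \<Rightarrow> complex"
  Rsym :: "'a \<Rightarrow> 'a \<Rightarrow> 'a \<Rightarrow> complex mat"
  piv  :: "'a \<Rightarrow> int"

definition left_index :: "'a mtc_data \<Rightarrow> 'a \<Rightarrow> 'a \<Rightarrow> 'a \<Rightarrow> 'a \<Rightarrow> ('a \<times> nat \<times> nat) set" where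
  "left_index C a b c d = {(e, \<alpha>, \<beta>). \<alpha> < fus C a b e \<and> \<beta> < fus C e c d}"

definition right_index :: "'a mtc_data \<Rightarrow> 'a \<Rightarrow> 'a \<Rightarrow> 'a \<Rightarrow> 'a \<Rightarrow> ('a \<times> nat \<times> nat) set" where
  "right_index C a b c d = {(f, \<mu>, \<nu>). \<mu> < fus C b c f \<and> \<nu> < fus C a f d}"

abbreviation matrix_inverse :: "complex mat \<Rightarrow> complex mat" where
  "matrix_inverse A \<equiv> the (mat_inverse A)"

definition dual :: "'a mtc_data \<Rightarrow> 'a \<Rightarrow> 'a" where
  "dual C a = (THE b. fus C a b (vac C) \<noteq> 0)"

definition fusion_rules :: "('a::finite) mtc_data \<Rightarrow> bool" where
  "fusion_rules C \<longleftrightarrow>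
     (\<forall>a b. fus C (vac C) a b = (if a = b then 1 else 0)) \<and>
     (\<forall>a b. fus C a (vac C) b = (if a = b then 1 else 0)) \<and>
     (\<forall>a b c. fus C a b c = fus C b a c) \<and>
     (\<forall>a b c d. (\<Sum>e\<in>UNIV. fus C a b e * fus C e c d) = (\<Sum>f\<in>UNIV. fus C b c f * fus C a f d)) \<and>
     (\<forall>a. \<exists>!b. fus C a b (vac C) \<noteq> 0) \<and>
     (\<forall>a. fus C a (dual C a) (vac C) = 1)"

definition F_invertible :: "('a::finite) mtc_data \<Rightarrow> bool" where
  "F_invertible C \<longleftrightarrow> (\<forall>a b c d. \<exists>G.
     (\<forall>i\<in>left_index C a b c d. \<forall>i'\<in>left_index C a b c d.
        (\<Sum>j\<in>right_index C a b c d. Fsym C a b c d i j * G j i') = (if i = i' then 1 else 0)) \<and>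
     (\<forall>j\<in>right_index C a b c d. \<forall>j'\<in>right_index C a b c d.
        (\<Sum>i\<in>left_index C a b c d. G j i * Fsym C a b c d i j') = (if j = j' then 1 else 0)))"

text \<open>
  As usual, the one-dimensional spaces $V_{1a}^a$ and $V_{a1}^a$ carry their canonical bases (the
  unit isomorphisms), so that the triangle axiom says that $F_{a1c}^d$ is an identity matrix.
\<close>

definition triangle :: "('a::finite) mtc_data \<Rightarrow> bool" where
  "triangle C \<longleftrightarrow> (\<forall>a c d \<beta> \<nu>. \<beta> < fus C a c d \<longrightarrow> \<nu> < fus C a c d \<longrightarrow>
     Fsym C a (vac C) c d (a, 0, \<beta>) (c, 0, \<nu>) = (if \<beta> = \<nu> then 1 else 0))"

definition pentagon :: "('a::finite) mtc_data \<Rightarrow> bool" where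
  "pentagon C \<longleftrightarrow>
     (\<forall>a b c d e f g k l \<alpha> \<beta> \<gamma> \<delta> \<kappa> \<mu>.
        \<alpha> < fus C a b f \<longrightarrow> \<beta> < fus C f c g \<longrightarrow> \<gamma> < fus C g d e \<longrightarrow>
        \<delta> < fus C c d l \<longrightarrow> \<kappa> < fus C b l k \<longrightarrow> \<mu> < fus C a k e \<longrightarrow>
        (\<Sum>\<nu><fus C f l e. Fsym C f c d e (g, \<beta>, \<gamma>) (l, \<delta>, \<nu>) * Fsym C a b l e (f, \<alpha>, \<nu>) (k, \<kappa>, \<mu>)) =
        (\<Sum>h\<in>UNIV. \<Sum>\<sigma><fus C b c h. \<Sum>\<psi><fus C a h g. \<Sum>\<rho><fus C h d k.
           Fsym C a b c g (f, \<alpha>, \<beta>) (h, \<sigma>, \<psi>) * Fsym C a h d e (g, \<psi>, \<gamma>) (k, \<rho>, \<mu>) *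
           Fsym C b c d k (h, \<sigma>, \<rho>) (l, \<delta>, \<kappa>)))"

text \<open>
  The two hexagon axioms are one equation, for the braiding $R_{ab}^c$ and for the reverse braiding
  $(R_{ba}^c)^{-1}$.
\<close>

definition hexagon :: "('a::finite) mtc_data \<Rightarrow> ('a \<Rightarrow> 'a \<Rightarrow> 'a \<Rightarrow> complex mat) \<Rightarrow> bool" where
  "hexagon C B \<longleftrightarrow>
     (\<forall>a b c d e g \<alpha> \<beta> \<mu> \<nu>.
        \<alpha> < fus C c a e \<longrightarrow> \<beta> < fus C e b d \<longrightarrow> \<mu> < fus C b c g \<longrightarrow> \<nu> < fus C a g d \<longrightarrow>
        (\<Sum>\<kappa><fus C a c e. \<Sum>\<gamma><fus C c b g.
           B a c e $$ (\<alpha>, \<kappa>) * Fsym C a c b d (e, \<kappa>, \<beta>) (g, \<gamma>, \<nu>) * B b c g $$ (\<gamma>, \<mu>)) =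
        (\<Sum>f\<in>UNIV. \<Sum>\<delta><fus C a b f. \<Sum>\<sigma><fus C c f d. \<Sum>\<psi><fus C f c d.
           Fsym C c a b d (e, \<alpha>, \<beta>) (f, \<delta>, \<sigma>) * B f c d $$ (\<sigma>, \<psi>) *
           Fsym C a b c d (f, \<delta>, \<psi>) (g, \<mu>, \<nu>)))"

definition braiding :: "('a::finite) mtc_data \<Rightarrow> bool" where
  "braiding C \<longleftrightarrow>
     (\<forall>a b c. Rsym C a b c \<in> carrier_mat (fus C b a c) (fus C a b c) \<and>
              invertible_mat (Rsym C a b c)) \<and>
     hexagon C (Rsym C) \<and>
     hexagon C (\<lambda>a b c. matrix_inverse (Rsym C b a c))"

text \<open>
  Rigidity: the zigzag built from $V_{a\bar a}^1$ and $V_{\bar a a}^1$ does not vanish.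
\<close>

definition rigid :: "('a::finite) mtc_data \<Rightarrow> bool" where
  "rigid C \<longleftrightarrow> (\<forall>a. Fsym C a (dual C a) a a (vac C, 0, 0) (vac C, 0, 0) \<noteq> 0)"

text \<open>
  Pivotal axiom: the composite
  $V_{ab}^c \to V_{b\bar c}^{\bar a} \to V_{\bar c a}^{\bar b} \to V_{ab}^c$ of three F moves is
  the scalar $\epsilon_a\epsilon_b\epsilon_c$ (the pivotal structure is an involution,
  so no inverses are needed).
\<close>

definition pivotal :: "('a::finite) mtc_data \<Rightarrow> bool" where
  "pivotal C \<longleftrightarrow>
     (\<forall>a. piv C a \<in> {1, -1}) \<and> piv C (vac C) = 1 \<and> (\<forall>a. piv C (dual C a) = piv C a) \<and>
     (\<forall>a b c \<alpha> \<alpha>'. \<alpha> < fus C a b c \<longrightarrow> \<alpha>' < fus C a b c \<longrightarrow>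
        (let a' = dual C a; b' = dual C b; c' = dual C c; u = vac C in
          (\<Sum>\<mu><fus C b c' a'. \<Sum>\<sigma><fus C c' a b'.
             Fsym C a b c' u (c, \<alpha>, 0) (a', \<mu>, 0) * Fsym C b c' a u (a', \<mu>, 0) (b', \<sigma>, 0) *
             Fsym C c' a b u (b', \<sigma>, 0) (c, \<alpha>', 0))
          = (if \<alpha> = \<alpha>' then of_int (piv C a * piv C b * piv C c) else 0)))"

definition qdim :: "('a::finite) mtc_data \<Rightarrow> 'a \<Rightarrow> complex" where
  "qdim C a = of_int (piv C a) / Fsym C a (dual C a) a a (vac C, 0, 0) (vac C, 0, 0)"

definition spherical :: "('a::finite) mtc_data \<Rightarrow> bool" where
  "spherical C \<longleftrightarrow> (\<forall>a. qdim C a = qdim C (dual C a))"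

text \<open>The unnormalised S matrix: the quantum trace of the double braiding.\<close>

definition S_matrix :: "('a::finite) mtc_data \<Rightarrow> complex ^ 'a ^ 'a" where
  "S_matrix C = (\<chi> a b. \<Sum>c\<in>UNIV. qdim C c *
     (\<Sum>\<mu><fus C b a c. (Rsym C a b c * Rsym C b a c) $$ (\<mu>, \<mu>)))"

definition mtc :: "('a::finite) mtc_data \<Rightarrow> bool" where
  "mtc C \<longleftrightarrow> fusion_rules C \<and> F_invertible C \<and> triangle C \<and> pentagon C \<and> braiding C \<and>
     rigid C \<and> pivotal C \<and> spherical C \<and> Finite_Cartesian_Product.invertible (S_matrix C)"


section \<open>Change of gauge\<close>

text \<open>
  \<open>C'\<close> presents the same category as \<open>C\<close>, in the bases
  $|a,b,c;\mu\rangle' = \sum_{\mu'} \Gamma(a,b,c)_{\mu\mu'} |a,b,c;\mu'\rangle$ of the fusion spaces.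
\<close>

definition gauge_equivalent :: "('a::finite) mtc_data \<Rightarrow> 'a mtc_data \<Rightarrow> bool" where
  "gauge_equivalent C C' \<longleftrightarrow>
     vac C' = vac C \<and> fus C' = fus C \<and> piv C' = piv C \<and>
     (\<exists>\<Gamma>.
       (\<forall>a b c. \<Gamma> a b c \<in> carrier_mat (fus C a b c) (fus C a b c) \<and> invertible_mat (\<Gamma> a b c)) \<and>
       (\<forall>a b c. Rsym C' a b c = \<Gamma> b a c * Rsym C a b c * matrix_inverse (\<Gamma> a b c)) \<and>
       (\<forall>a b c d e f \<alpha> \<beta> \<mu> \<nu>.
          (e, \<alpha>, \<beta>) \<in> left_index C a b c d \<longrightarrow> (f, \<mu>, \<nu>) \<in> right_index C a b c d \<longrightarrow>
          Fsym C' a b c d (e, \<alpha>, \<beta>) (f, \<mu>, \<nu>) =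
          (\<Sum>\<alpha>'<fus C a b e. \<Sum>\<beta>'<fus C e c d. \<Sum>\<mu>'<fus C b c f. \<Sum>\<nu>'<fus C a f d.
             \<Gamma> a b e $$ (\<alpha>, \<alpha>') * \<Gamma> e c d $$ (\<beta>, \<beta>') *
             Fsym C a b c d (e, \<alpha>', \<beta>') (f, \<mu>', \<nu>') *
             matrix_inverse (\<Gamma> b c f) $$ (\<mu>', \<mu>) * matrix_inverse (\<Gamma> a f d) $$ (\<nu>', \<nu>))))"


section \<open>Galois conjugation\<close>

abbreviation complex_ring :: "complex ring" where
  "complex_ring \<equiv> ring_of_type_algebra"

definition symbol_entries :: "('a::finite) mtc_data \<Rightarrow> complex set" where
  "symbol_entries C =
     {Fsym C a b c d i j | a b c d i j. i \<in> left_index C a b c d \<and> j \<in> right_index C a b c d} \<union>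
     {Rsym C a b c $$ (\<mu>, \<nu>) | a b c \<mu> \<nu>. \<mu> < fus C b a c \<and> \<nu> < fus C a b c}"

definition symbol_field :: "('a::finite) mtc_data \<Rightarrow> complex set" where
  "symbol_field C = generate_field complex_ring (symbol_entries C)"

definition number_field_gauge :: "('a::finite) mtc_data \<Rightarrow> bool" where
  "number_field_gauge C \<longleftrightarrow> ring.finite_dimension complex_ring \<rat> (symbol_field C)"

definition normal_over_rationals :: "complex set \<Rightarrow> bool" where
  "normal_over_rationals L \<longleftrightarrow> subfield L complex_ring \<and> (\<forall>x\<in>L. algebraic x) \<and>
     (\<forall>p :: rat poly. Factorial_Ring.irreducible p \<and> (\<exists>x\<in>L. poly (map_poly of_rat p) x = 0) \<longrightarrow>
        (\<forall>z. poly (map_poly of_rat p) z = 0 \<longrightarrow> z \<in> L))"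

definition normal_closure :: "complex set \<Rightarrow> complex set" where
  "normal_closure K = \<Inter> {L. normal_over_rationals L \<and> K \<subseteq> L}"

definition galois_group :: "complex set \<Rightarrow> (complex \<Rightarrow> complex) set" where
  "galois_group L =
     {q \<in> ring_iso (complex_ring\<lparr>carrier := L\<rparr>) (complex_ring\<lparr>carrier := L\<rparr>). \<forall>x\<in>\<rat>. q x = x}"

definition K_field :: "('a::finite) mtc_data \<Rightarrow> complex set" where
  "K_field C = normal_closure (symbol_field C)"

definition galois_conjugate :: "(complex \<Rightarrow> complex) \<Rightarrow> 'a mtc_data \<Rightarrow> 'a mtc_data" where
  "galois_conjugate q C =
     C\<lparr>Fsym := \<lambda>a b c d i j. q (Fsym C a b c d i j), Rsym := \<lambda>a b c. map_mat q (Rsym C a b c)\<rparr>"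


section \<open>0-form symmetries\<close>

type_synonym 'a symmetry = "('a \<Rightarrow> 'a) \<times> ('a \<Rightarrow> 'a \<Rightarrow> 'a \<Rightarrow> complex mat)"

text \<open>
  A pair \<open>(g, U)\<close> acts on the fusion spaces by
  $|a,b,c;\mu\rangle \mapsto \sum_{\mu'} U(g(a),g(b),g(c))_{\mu\mu'} |g(a),g(b),g(c);\mu'\rangle$.
\<close>

definition linear_symmetries :: "('a::finite) mtc_data \<Rightarrow> 'a symmetry set" where
  "linear_symmetries C = {(g, U).
     bij g \<and> (\<forall>a b c. fus C (g a) (g b) (g c) = fus C a b c) \<and>
     (\<forall>a b c. U a b c \<in> carrier_mat (fus C a b c) (fus C a b c) \<and> invertible_mat (U a b c)) \<and>
     (\<forall>a b c. U (g b) (g a) (g c) * Rsym C (g a) (g b) (g c) * matrix_inverse (U (g a) (g b) (g c))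
        = Rsym C a b c) \<and>
     (\<forall>a b c d e f \<alpha> \<beta> \<mu> \<nu>.
        (e, \<alpha>, \<beta>) \<in> left_index C a b c d \<longrightarrow> (f, \<mu>, \<nu>) \<in> right_index C a b c d \<longrightarrow>
        (\<Sum>\<alpha>'<fus C a b e. \<Sum>\<beta>'<fus C e c d. \<Sum>\<mu>'<fus C b c f. \<Sum>\<nu>'<fus C a f d.
           U (g a) (g b) (g e) $$ (\<alpha>, \<alpha>') * U (g e) (g c) (g d) $$ (\<beta>, \<beta>') *
           Fsym C (g a) (g b) (g c) (g d) (g e, \<alpha>', \<beta>') (g f, \<mu>', \<nu>') *
           matrix_inverse (U (g b) (g c) (g f)) $$ (\<mu>', \<mu>) *
           matrix_inverse (U (g a) (g f) (g d)) $$ (\<nu>', \<nu>))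
        = Fsym C a b c d (e, \<alpha>, \<beta>) (f, \<mu>, \<nu>))}"

definition unitary_mat :: "complex mat \<Rightarrow> bool" where
  "unitary_mat A \<longleftrightarrow> square_mat A \<and> inverts_mat A (mat_adjoint A) \<and> inverts_mat (mat_adjoint A) A"

definition unitary_symmetries :: "('a::finite) mtc_data \<Rightarrow> 'a symmetry set" where
  "unitary_symmetries C = {(g, U) \<in> linear_symmetries C. \<forall>a b c. unitary_mat (U a b c)}"

text \<open>
  Composition of the induced maps on fusion spaces (the right factor acts first): applying \<open>(g, U)\<close>
  and then \<open>(h, V)\<close> sends $|a,b,c\rangle$ to
  $U(g(a),g(b),g(c))\,V(hg(a),hg(b),hg(c))\,|hg(a),hg(b),hg(c)\rangle$.
\<close>

fun compose_symmetry :: "'a symmetry \<Rightarrow> 'a symmetry \<Rightarrow> 'a symmetry" where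
  "compose_symmetry (h, V) (g, U) =
     (h \<circ> g, \<lambda>x y z. U (inv_into UNIV h x) (inv_into UNIV h y) (inv_into UNIV h z) * V x y z)"

definition natural_isomorphism :: "'a mtc_data \<Rightarrow> ('a \<Rightarrow> complex) \<Rightarrow> 'a symmetry" where
  "natural_isomorphism C \<gamma> = (id, \<lambda>a b c. (\<gamma> a * \<gamma> b / \<gamma> c) \<cdot>\<^sub>m 1\<^sub>m (fus C a b c))"

definition symmetry_monoid :: "'a mtc_data \<Rightarrow> 'a symmetry set \<Rightarrow> 'a symmetry monoid" where
  "symmetry_monoid C S =
     \<lparr>carrier = S, monoid.mult = compose_symmetry, one = (id, \<lambda>a b c. 1\<^sub>m (fus C a b c))\<rparr>"

definition unitary_symmetry_group :: "('a::finite) mtc_data \<Rightarrow> 'a symmetry set monoid" where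
  "unitary_symmetry_group C =
     symmetry_monoid C (unitary_symmetries C) Mod natural_isomorphism C ` {\<gamma>. \<forall>a. cmod (\<gamma> a) = 1}"

text \<open>
  The gauge-independent group of all braided autoequivalences, in which unitarity of the matrices
  is dropped and correspondingly all nonzero numbers \<open>\<gamma> a\<close> are allowed.
\<close>

definition linear_symmetry_group :: "('a::finite) mtc_data \<Rightarrow> 'a symmetry set monoid" where
  "linear_symmetry_group C =
     symmetry_monoid C (linear_symmetries C) Mod natural_isomorphism C ` {\<gamma>. \<forall>a. \<gamma> a \<noteq> 0}"

text \<open>
  Unitarity of the matrix of a map between fusion spaces is not invariant under a change of basis,
  so \<open>unitary_symmetry_group\<close> depends on the gauge.  It is the symmetry group of the category in
  those gauges in which the symmetries do act by unitary matrices, up to natural isomorphism;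
  rescaling a basis vector in an arbitrary gauge can destroy symmetries.
\<close>

definition unitary_gauge :: "('a::finite) mtc_data \<Rightarrow> bool" where
  "unitary_gauge C \<longleftrightarrow>
     (\<forall>s\<in>linear_symmetries C. \<exists>\<gamma>. (\<forall>a. \<gamma> a \<noteq> 0) \<and>
        compose_symmetry (natural_isomorphism C \<gamma>) s \<in> unitary_symmetries C)"

end

theory Submission
  imports Defs
begin

text \<open>
  The matrices of a symmetry need not have entries in \<open>K_field C\<close>, so \<open>q\<close> is first extended to a
  (wild) automorphism \<open>\<sigma>\<close> of the whole field of complex numbers.  Applying \<open>\<sigma>\<close> to the entries of
  all matrices maps the solutions of the defining equations for \<open>C\<close> bijectively to those for
  \<open>q(C)\<close>, and natural isomorphisms to natural isomorphisms; this settles the linear groups.  A change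
  of gauge conjugates the linear symmetries and hence does not affect the linear group.  In a gauge in
  which every symmetry is unitary up to a natural isomorphism, the inclusion of the unitary symmetries
  into the linear ones induces an isomorphism of the quotients, because a natural isomorphism that
  acts unitarily is given by phases.
\<close>

section \<open>Extending automorphisms of subfields\<close>

text \<open>The automorphism \<sigma> is in general discontinuous and does not commute with complex
  conjugation. It therefore need not carry unitary matrices to unitary matrices, nor phases to
  phases. The equations with R and F, invertibility, and \<open>\<gamma> a \<noteq> 0\<close> are
  purely algebraic and do survive. This is why the linear group is the bridge between the two sides,
  and why unitarity is treated separately on each of them.

  Partial isomorphisms of fields are kept as graphs: Zorn's lemma then concerns inclusion of sets,
  and exchanging domain and range is taking the converse.

  Symmetries and changes of gauge are arrows of one groupoid whose objects are presentations by F
  and R symbols. The three comparisons of quotients (inclusion of unitary symmetries, conjugation by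
  an arrow, application of \<sigma>) are instances of one form of the first isomorphism theorem, in
  which a homomorphism need only be surjective modulo the normal subgroup.\<close>

definition partial_field_iso :: "('k::field \<times> 'k) set \<Rightarrow> bool" where
  "partial_field_iso G \<longleftrightarrow> (1, 1) \<in> G \<and>
     (\<forall>x x' y y'. (x, x') \<in> G \<longrightarrow> (y, y') \<in> G \<longrightarrow> (x - y, x' - y') \<in> G \<and> (x / y, x' / y') \<in> G) \<and>
     (\<forall>x x'. (x, x') \<in> G \<longrightarrow> (x = 0 \<longleftrightarrow> x' = 0))"

text \<open>Subtraction and division generate the other operations: x + y = x - (0 - y) and x * y =
  x / (1 / y). As division by 0 yields 0 and zeros correspond to zeros, closure under division needs
  no side condition.\<close>

lemma partial_field_isoD:
  assumes "partial_field_iso G"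
  shows "(1, 1) \<in> G" "(0, 0) \<in> G"
    "(x, x') \<in> G \<Longrightarrow> (y, y') \<in> G \<Longrightarrow> (x - y, x' - y') \<in> G"
    "(x, x') \<in> G \<Longrightarrow> (y, y') \<in> G \<Longrightarrow> (x / y, x' / y') \<in> G"
    "(x, x') \<in> G \<Longrightarrow> (y, y') \<in> G \<Longrightarrow> (x + y, x' + y') \<in> G"
    "(x, x') \<in> G \<Longrightarrow> (y, y') \<in> G \<Longrightarrow> (x * y, x' * y') \<in> G"
    "(x, x') \<in> G \<Longrightarrow> x = 0 \<longleftrightarrow> x' = 0"
proof -
  show 1: "(1, 1) \<in> G"
    and d: "\<And>x x' y y'. (x, x') \<in> G \<Longrightarrow> (y, y') \<in> G \<Longrightarrow> (x - y, x' - y') \<in> G"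
    and q: "\<And>x x' y y'. (x, x') \<in> G \<Longrightarrow> (y, y') \<in> G \<Longrightarrow> (x / y, x' / y') \<in> G"
    and "(x, x') \<in> G \<Longrightarrow> x = 0 \<longleftrightarrow> x' = 0"
    using assms unfolding partial_field_iso_def by blast+
  show 0: "(0, 0) \<in> G" using d[OF 1 1] by simp
  show "(x + y, x' + y') \<in> G" if "(x, x') \<in> G" "(y, y') \<in> G"
    using d[OF that(1) d[OF 0 that(2)]] by simp
  show "(x * y, x' * y') \<in> G" if "(x, x') \<in> G" "(y, y') \<in> G"
    using q[OF that(1) q[OF 1 that(2)]] by simp
qed

text \<open>The difference of the two pairs is (0, y - z), and zero corresponds only to zero.
  Applied to the converse relation this gives injectivity.\<close>

lemma partial_field_iso_fun:
  assumes "partial_field_iso G" "(x, y) \<in> G" "(x, z) \<in> G"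
  shows "y = z"
  using partial_field_isoD(7)[OF assms(1) partial_field_isoD(3)[OF assms]] by simp

lemma partial_field_iso_converse: "partial_field_iso G \<Longrightarrow> partial_field_iso (G\<inverse>)"
  by (auto simp: partial_field_iso_def)

text \<open>Each closure condition involves at most two pairs, and any two pairs lie in a common
  member of the chain.\<close>

lemma partial_field_iso_Union:
  assumes "\<And>G. G \<in> \<C> \<Longrightarrow> partial_field_iso G" "\<C> \<noteq> {}" "subset.chain A \<C>"
  shows "partial_field_iso (\<Union>\<C>)"
proof -
  have common: "\<exists>G\<in>\<C>. u \<in> G \<and> v \<in> G" if uv: "u \<in> \<Union>\<C>" "v \<in> \<Union>\<C>" for u v
  proof -
    obtain G H where GH: "G \<in> \<C>" "u \<in> G" "H \<in> \<C>" "v \<in> H" using uv by blast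
    then have "G \<subseteq> H \<or> H \<subseteq> G" using assms(3) by (meson subset_chain_def)
    then show ?thesis using GH by blast
  qed
  have "(x - y, x' - y') \<in> \<Union>\<C> \<and> (x / y, x' / y') \<in> \<Union>\<C>"
    if xy: "(x, x') \<in> \<Union>\<C>" "(y, y') \<in> \<Union>\<C>" for x x' y y'
  proof -
    obtain G where "G \<in> \<C>" "(x, x') \<in> G" "(y, y') \<in> G" using common[OF xy] by blast
    then show ?thesis using partial_field_isoD(3,4)[OF assms(1)] by blast
  qed
  moreover have "(1, 1) \<in> \<Union>\<C>" using partial_field_isoD(1)[OF assms(1)] assms(2) by blast
  moreover have "x = 0 \<longleftrightarrow> x' = 0" if "(x, x') \<in> \<Union>\<C>" for x x'
    using that partial_field_isoD(7)[OF assms(1)] by blast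
  ultimately show ?thesis unfolding partial_field_iso_def by blast
qed

section \<open>Polynomials with corresponding coefficients, and simple extensions\<close>

definition poly_rel :: "('k::field \<times> 'k) set \<Rightarrow> 'k poly \<Rightarrow> 'k poly \<Rightarrow> bool" where
  "poly_rel G p p' \<longleftrightarrow> (\<forall>i. (poly.coeff p i, poly.coeff p' i) \<in> G)"

context
  fixes G :: "('k::field \<times> 'k) set"
  assumes G: "partial_field_iso G"
begin

lemma poly_rel_diff: "poly_rel G p p' \<Longrightarrow> poly_rel G r r' \<Longrightarrow> poly_rel G (p - r) (p' - r')"
  by (simp add: poly_rel_def partial_field_isoD(3)[OF G])

lemma poly_rel_add: "poly_rel G p p' \<Longrightarrow> poly_rel G r r' \<Longrightarrow> poly_rel G (p + r) (p' + r')"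
  by (simp add: poly_rel_def partial_field_isoD(5)[OF G])

lemma poly_rel_monom: "(c, c') \<in> G \<Longrightarrow> poly_rel G (Polynomial.monom c n) (Polynomial.monom c' n)"
  by (simp add: poly_rel_def partial_field_isoD(2)[OF G])

lemma poly_rel_0: "poly_rel G 0 0"
  by (simp add: poly_rel_def partial_field_isoD(2)[OF G])

lemma poly_rel_mult:
  assumes "poly_rel G p p'" "poly_rel G r r'"
  shows "poly_rel G (p * r) (p' * r')"
proof -
  have "((\<Sum>i\<in>I. poly.coeff p i * poly.coeff r (n - i)), (\<Sum>i\<in>I. poly.coeff p' i * poly.coeff r' (n - i))) \<in> G"
    if "finite I" for I and n :: nat
    using that
  proof (induction I rule: finite_induct)
    case empty
    then show ?case by (simp add: partial_field_isoD(2)[OF G])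
  next
    case (insert i I)
    then show ?case
      using assms by (auto simp: poly_rel_def intro!: partial_field_isoD(5,6)[OF G])
  qed
  then show ?thesis by (simp add: poly_rel_def Polynomial.coeff_mult)
qed

lemma poly_rel_degree: "poly_rel G p p' \<Longrightarrow> Polynomial.degree p = Polynomial.degree p'"
proof -
  assume "poly_rel G p p'"
  then have "poly.coeff p i = 0 \<longleftrightarrow> poly.coeff p' i = 0" for i
    using partial_field_isoD(7)[OF G] unfolding poly_rel_def by blast
  then show ?thesis unfolding Polynomial.degree_def by simp
qed

lemma poly_rel_eq_0: "poly_rel G p p' \<Longrightarrow> p = 0 \<longleftrightarrow> p' = 0"
  unfolding poly_rel_def poly_eq_iff coeff_0 using partial_field_isoD(7)[OF G] by blast

text \<open>Long division is run on both sides at once. Related polynomials have equal degrees and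
  related leading coefficients, so each step subtracts related multiples, and quotients and
  remainders stay related.\<close>

lemma poly_rel_division:
  assumes m: "poly_rel G m m'" "m \<noteq> 0" and "poly_rel G a a'"
  obtains d d' r r' where "poly_rel G d d'" "poly_rel G r r'"
    "a = m * d + r" "a' = m' * d' + r'" "r = 0 \<or> Polynomial.degree r < Polynomial.degree m"
proof -
  have "\<exists>d d' r r'. poly_rel G d d' \<and> poly_rel G r r' \<and> a = m * d + r \<and> a' = m' * d' + r' \<and>
          (r = 0 \<or> Polynomial.degree r < Polynomial.degree m)"
    using assms(3)
  \<comment> \<open>The measure gives 0 only to the zero polynomial: the degree alone would not drop
    when a nonzero constant is reduced to 0.\<close>
  proof (induction "if a = 0 then 0 else Suc (Polynomial.degree a)" arbitrary: a a' rule: less_induct)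
    case less
    show ?case
    proof (cases "a = 0 \<or> Polynomial.degree a < Polynomial.degree m")
      case True
      then show ?thesis
        using less.prems poly_rel_0
        by (intro exI[of _ 0] exI[of _ a] exI[of _ a'] conjI) auto
    next
      case False
      define n where "n = Polynomial.degree a - Polynomial.degree m"
      define t t' where "t = Polynomial.monom (Polynomial.lead_coeff a / Polynomial.lead_coeff m) n"
        and "t' = Polynomial.monom (Polynomial.lead_coeff a' / Polynomial.lead_coeff m') n"
      have t: "poly_rel G t t'"
        unfolding t_def t'_def
        using less.prems m(1) poly_rel_degree[OF less.prems] poly_rel_degree[OF m(1)]
        by (intro poly_rel_monom partial_field_isoD(4)[OF G]) (auto simp: poly_rel_def)
      have b: "poly_rel G (a - m * t) (a' - m' * t')"
        by (intro poly_rel_diff less.prems poly_rel_mult m t)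
      have "Polynomial.degree (a - m * t) \<le> Polynomial.degree a"
        using False degree_mult_le[of m t] degree_monom_le[of "Polynomial.lead_coeff a / Polynomial.lead_coeff m" n]
        by (intro degree_diff_le) (auto simp: t_def n_def)
      moreover have "poly.coeff (a - m * t) (Polynomial.degree a) = 0"
      proof -
        have "poly.coeff (m * t) (Polynomial.degree m + n) = Polynomial.lead_coeff a"
          using m(2) by (simp add: t_def mult.commute[of m] coeff_monom_mult)
        then show ?thesis using False by (simp add: n_def)
      qed
      ultimately have "a - m * t = 0 \<or> Polynomial.degree (a - m * t) < Polynomial.degree a"
        by (rule eq_zero_or_degree_less)
      then have "(if a - m * t = 0 then 0 else Suc (Polynomial.degree (a - m * t)))
          < (if a = 0 then 0 else Suc (Polynomial.degree a))"
        using False by auto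
      note less.hyps[OF this b]
      then obtain d d' r r' where *: "poly_rel G d d'" "poly_rel G r r'"
        "a - m * t = m * d + r" "a' - m' * t' = m' * d' + r'"
        "r = 0 \<or> Polynomial.degree r < Polynomial.degree m"
        by (elim exE conjE) rule
      then show ?thesis
        by (intro exI[of _ "d + t"] exI[of _ "d' + t'"] exI[of _ r] exI[of _ r'])
           (auto simp: algebra_simps intro: poly_rel_add t)
    qed
  qed
  then show ?thesis using that by blast
qed

text \<open>\<open>H\<close> is the graph of the isomorphism of the generated fields that sends x to
  y. The hypothesis says that x and y satisfy corresponding algebraic relations, which makes
  fractions well defined and injectively mapped. It covers both cases: a root of a conjugate minimal
  polynomial, and elements transcendental on both sides.\<close>

lemma simple_extension:
  assumes xy: "\<And>p p'. poly_rel G p p' \<Longrightarrow> poly p x = 0 \<longleftrightarrow> poly p' y = 0"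
  defines "H \<equiv> {(poly p x / poly r x, poly p' y / poly r' y) | p p' r r'.
                  poly_rel G p p' \<and> poly_rel G r r' \<and> poly r x \<noteq> 0}"
  shows "partial_field_iso H" "G \<subseteq> H" "(x, y) \<in> H"
proof -
  have HI: "(poly p x / poly r x, poly p' y / poly r' y) \<in> H"
    if "poly_rel G p p'" "poly_rel G r r'" "poly r x \<noteq> 0" for p p' r r'
    using that unfolding H_def by blast
  have one: "poly_rel G 1 1"
    using poly_rel_monom[OF partial_field_isoD(1)[OF G], of 0] by simp
  show "G \<subseteq> H"
  proof
    fix u assume "u \<in> G"
    then show "u \<in> H"
      using HI[OF poly_rel_monom[of "fst u" "snd u" 0] one] by (simp add: poly_monom)
  qed
  show "(x, y) \<in> H"
    using HI[OF poly_rel_monom[OF partial_field_isoD(1)[OF G], of 1] one] by (simp add: poly_monom)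
  have "(u - v, u' - v') \<in> H \<and> (u / v, u' / v') \<in> H" if uv: "(u, u') \<in> H" "(v, v') \<in> H" for u u' v v'
  proof -
    obtain p p' r r' where p: "u = poly p x / poly r x" "u' = poly p' y / poly r' y"
      "poly_rel G p p'" "poly_rel G r r'" "poly r x \<noteq> 0"
      using uv(1) unfolding H_def by blast
    obtain s s' t t' where s: "v = poly s x / poly t x" "v' = poly s' y / poly t' y"
      "poly_rel G s s'" "poly_rel G t t'" "poly t x \<noteq> 0"
      using uv(2) unfolding H_def by blast
    have nz: "poly r' y \<noteq> 0" "poly t' y \<noteq> 0" using xy p s by blast+
    have "poly_rel G (p * t - s * r) (p' * t' - s' * r')" "poly_rel G (r * t) (r' * t')"
      by (intro poly_rel_diff poly_rel_mult p s)+
    from HI[OF this] have "(u - v, u' - v') \<in> H"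
      using p s nz by (simp add: diff_frac_eq)
    moreover have "(u / v, u' / v') \<in> H"
    proof (cases "poly s x = 0")
      \<comment> \<open>Here v and v' both vanish, so both quotients are 0 by the convention for
        division by zero, and 0 = 0 / 1 is related to itself.\<close>
      case True
      then show ?thesis
        using HI[OF poly_rel_0 one] xy[OF s(3)] s by simp
    next
      case False
      have "poly_rel G (p * t) (p' * t')" "poly_rel G (r * s) (r' * s')"
        by (intro poly_rel_mult p s)+
      from HI[OF this] show ?thesis using False p s nz by simp
    qed
    ultimately show ?thesis by blast
  qed
  moreover have "u = 0 \<longleftrightarrow> u' = 0" if "(u, u') \<in> H" for u u'
    using that xy unfolding H_def by auto
  ultimately show "partial_field_iso H"
    using \<open>G \<subseteq> H\<close> partial_field_isoD(1)[OF G] unfolding partial_field_iso_def by blast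
qed

end

text \<open>
  A root of the conjugate of the minimal polynomial of \<open>x\<close> satisfies the same algebraic relations
  over the range as \<open>x\<close> does over the domain.
\<close>

lemma algebraic_extension:
  fixes G :: "('k::alg_closed_field \<times> 'k) set"
  assumes G: "partial_field_iso G"
    and p: "p \<noteq> 0" "\<And>i. poly.coeff p i \<in> Domain G" "poly p x = 0"
  shows "\<exists>H y. partial_field_iso H \<and> G \<subseteq> H \<and> (x, y) \<in> H"
proof -
  \<comment> \<open>The degrees of nonzero polynomials over the domain that vanish at x; a
    polynomial \<open>m\<close> of least degree is a minimal polynomial, not normalised to be
    monic.\<close>
  define P where "P = (\<lambda>n. \<exists>m m'. poly_rel G m m' \<and> m \<noteq> 0 \<and> poly m x = 0 \<and> Polynomial.degree m = n)"
  obtain f where f: "\<And>c. c \<in> Domain G \<Longrightarrow> (c, f c) \<in> G"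
    using bchoice[of "Domain G" "\<lambda>c d. (c, d) \<in> G"] by blast
  have f0: "f 0 = 0"
    using partial_field_isoD(7)[OF G f] partial_field_isoD(2)[OF G] by blast
  have "poly_rel G p (map_poly f p)"
    using f p(2) f0 by (simp add: poly_rel_def coeff_map_poly)
  then have "P (Polynomial.degree p)" using p unfolding P_def by blast
  then have "P (LEAST n. P n)" by (rule LeastI)
  then obtain m m' where m: "poly_rel G m m'" "m \<noteq> 0" "poly m x = 0" "Polynomial.degree m = (LEAST n. P n)"
    unfolding P_def by blast
  have minimal: "Polynomial.degree m \<le> Polynomial.degree r"
    if "poly_rel G r r'" "r \<noteq> 0" "poly r x = 0" for r r'
    unfolding m(4) by (rule Least_le) (use that in \<open>auto simp: P_def\<close>)
  have "Polynomial.degree m > 0"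
  proof (rule ccontr)
    assume "\<not> Polynomial.degree m > 0"
    then obtain c where "m = [:c:]" by (auto elim: degree_eq_zeroE)
    then show False using m(2,3) by simp
  qed
  then have "Polynomial.degree m' > 0" using poly_rel_degree[OF G m(1)] by simp
  then obtain y where y: "poly m' y = 0" using alg_closed_imp_poly_has_root by blast
  have forward: "poly r' y = 0" if r: "poly_rel G r r'" "poly r x = 0" for r r'
  proof -
    obtain d d' s s' where *: "poly_rel G d d'" "poly_rel G s s'"
      "r = m * d + s" "r' = m' * d' + s'" "s = 0 \<or> Polynomial.degree s < Polynomial.degree m"
      using poly_rel_division[OF G m(1,2) r(1)] .
    then have "poly s x = 0" using r(2) m(3) by simp
    then have "s = 0" using *(2,5) minimal by fastforce
    then have "s' = 0" using poly_rel_eq_0[OF G *(2)] by simp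
    then show ?thesis using *(4) y by simp
  qed
  \<comment> \<open>It is not yet known that \<open>m'\<close> is a minimal polynomial of y. The
    preimage \<open>k\<close> of one is compared with \<open>m\<close>.\<close>
  have backward: "poly r x = 0" if r: "poly_rel G r r'" "poly r' y = 0" for r r'
  proof -
    define Q where "Q = (\<lambda>n. \<exists>k k'. poly_rel G k k' \<and> k \<noteq> 0 \<and> poly k' y = 0 \<and> Polynomial.degree k = n)"
    have "Q (Polynomial.degree m)" using m y unfolding Q_def by blast
    then have "Q (LEAST n. Q n)" by (rule LeastI)
    then obtain k k' where k: "poly_rel G k k'" "k \<noteq> 0" "poly k' y = 0" "Polynomial.degree k = (LEAST n. Q n)"
      unfolding Q_def by blast
    have minimal': "Polynomial.degree k \<le> Polynomial.degree s"
      if "poly_rel G s s'" "s \<noteq> 0" "poly s' y = 0" for s s'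
      unfolding k(4) by (rule Least_le) (use that in \<open>auto simp: Q_def\<close>)
    have dvd: "\<exists>d d'. poly_rel G d d' \<and> s = k * d"
      if s: "poly_rel G s s'" "poly s' y = 0" for s s'
    proof -
      obtain d d' t t' where *: "poly_rel G d d'" "poly_rel G t t'"
        "s = k * d + t" "s' = k' * d' + t'" "t = 0 \<or> Polynomial.degree t < Polynomial.degree k"
        using poly_rel_division[OF G k(1,2) s(1)] .
      then have "poly t' y = 0" using s(2) k(3) by simp
      then have "t = 0" using *(2,5) minimal' by fastforce
      then show ?thesis using * by auto
    qed
    \<comment> \<open>Since \<open>k\<close> is not constant, the cofactor \<open>d\<close> has
      smaller degree than \<open>m\<close> and cannot vanish at x. Hence \<open>k\<close> does, and
      so does every multiple of it.\<close>
    obtain d d' where d: "poly_rel G d d'" "m = k * d" using dvd[OF m(1) y] by blast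
    have "Polynomial.degree k > 0"
    proof (rule ccontr)
      assume "\<not> Polynomial.degree k > 0"
      then have "Polynomial.degree k' = 0" using poly_rel_degree[OF G k(1)] by simp
      then obtain c where "k' = [:c:]" by (auto elim: degree_eq_zeroE)
      then show False using k(2,3) poly_rel_eq_0[OF G k(1)] by simp
    qed
    moreover have "d \<noteq> 0" using d m by auto
    ultimately have "Polynomial.degree d < Polynomial.degree m" using d(2) k(2) by (simp add: degree_mult_eq)
    then have "poly d x \<noteq> 0" using minimal[OF d(1) \<open>d \<noteq> 0\<close>] by fastforce
    then have "poly k x = 0" using m(3) d(2) by simp
    then show ?thesis using dvd[OF r] by auto
  qed
  show ?thesis
    using simple_extension[OF G, of x y] forward backward by blast
qed

text \<open>
  A maximal automorphism of a subfield extending the given one is found first: every \<open>x\<close>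
  transcendental over its domain could be adjoined by \<open>x \<mapsto> x\<close>, so everything is algebraic over its
  domain.  This makes domain and range of a maximal partial isomorphism above it everything;
  a maximal partial isomorphism above the original one need not be surjective.
\<close>

theorem extend_subfield_automorphism:
  fixes G0 :: "('k::alg_closed_field \<times> 'k) set"
  assumes G0: "partial_field_iso G0" "Domain G0 = Range G0"
  obtains \<sigma> :: "'k \<Rightarrow> 'k" where "bij \<sigma>" "\<And>x y. \<sigma> (x + y) = \<sigma> x + \<sigma> y" "\<And>x y. \<sigma> (x * y) = \<sigma> x * \<sigma> y"
    "\<And>x y. (x, y) \<in> G0 \<Longrightarrow> \<sigma> x = y"
proof -
  define \<F> where "\<F> = {G. partial_field_iso G \<and> Domain G = Range G \<and> G0 \<subseteq> G}"
  have "\<exists>G\<in>\<F>. \<forall>Y\<in>\<F>. G \<subseteq> Y \<longrightarrow> Y = G"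
  proof (rule subset_Zorn_nonempty)
    show "\<F> \<noteq> {}" using G0 by (auto simp: \<F>_def)
    fix \<C> assume c: "\<C> \<noteq> {}" "subset.chain \<F> \<C>"
    then have sub: "\<C> \<subseteq> \<F>" by (simp add: subset_chain_def)
    then have "partial_field_iso (\<Union>\<C>)"
      by (intro partial_field_iso_Union[OF _ c]) (auto simp: \<F>_def)
    moreover have "Domain (\<Union>\<C>) = Range (\<Union>\<C>)"
      proof -
      have "Domain S = Range S" if "S \<in> \<C>" for S using subsetD[OF sub that] by (simp add: \<F>_def)
      then show ?thesis by (simp add: Domain_Union Range_Union)
    qed
    moreover have "G0 \<subseteq> \<Union>\<C>"
    proof -
      obtain S where "S \<in> \<C>" using c(1) by blast
      with subsetD[OF sub this] show ?thesis by (auto simp: \<F>_def)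
    qed
    ultimately show "\<Union>\<C> \<in> \<F>" by (simp add: \<F>_def)
  qed
  then obtain G where "G \<in> \<F>" and maxG: "\<And>Y. Y \<in> \<F> \<Longrightarrow> G \<subseteq> Y \<Longrightarrow> Y = G"
    by metis
  then have G: "partial_field_iso G" "Domain G = Range G" "G0 \<subseteq> G" by (simp_all add: \<F>_def)
  have alg: "\<exists>p. p \<noteq> 0 \<and> (\<forall>i. poly.coeff p i \<in> Domain G) \<and> poly p x = 0" for x
  proof (rule ccontr)
    assume no: "\<nexists>p. p \<noteq> 0 \<and> (\<forall>i. poly.coeff p i \<in> Domain G) \<and> poly p x = 0"
    \<comment> \<open>As x is transcendental over the domain, which is also the range, each of two
      related polynomials vanishes at x only if it is zero.\<close>
    have xx: "poly p x = 0 \<longleftrightarrow> poly p' x = 0" if "poly_rel G p p'" for p p'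
    proof -
      have "poly.coeff p i \<in> Domain G" "poly.coeff p' i \<in> Domain G" for i
        using that G(2) by (auto simp: poly_rel_def)
      then have "poly p x = 0 \<longleftrightarrow> p = 0" "poly p' x = 0 \<longleftrightarrow> p' = 0" using no by auto
      then show ?thesis using poly_rel_eq_0[OF G(1) that] by simp
    qed
    define H where "H = {(poly p x / poly r x, poly p' x / poly r' x) | p p' r r'.
                  poly_rel G p p' \<and> poly_rel G r r' \<and> poly r x \<noteq> 0}"
    have H: "partial_field_iso H" "G \<subseteq> H" "(x, x) \<in> H"
      using simple_extension[OF G(1), of x x] xx unfolding H_def by blast+
    \<comment> \<open>Because domain and range agree, a polynomial over this field has both an image
      and a preimage under \<open>G\<close>; this keeps domain and range equal after x is
      adjoined.\<close>
    have right: "\<exists>p'. poly_rel G p p'" if pG: "\<forall>i. poly.coeff p i \<in> Domain G" for p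
    proof -
      obtain f where f: "\<And>c. c \<in> Domain G \<Longrightarrow> (c, f c) \<in> G"
    using bchoice[of "Domain G" "\<lambda>c d. (c, d) \<in> G"] by blast
      have "f 0 = 0"
        using partial_field_isoD(7)[OF G(1) f] partial_field_isoD(2)[OF G(1)] by blast
      then show ?thesis
        using f pG by (intro exI[of _ "map_poly f p"]) (simp add: poly_rel_def coeff_map_poly)
    qed
    have left: "\<exists>p. poly_rel G p p'" if pG: "\<forall>i. poly.coeff p' i \<in> Domain G" for p'
    proof -
      obtain f where f: "\<And>c. c \<in> Domain G \<Longrightarrow> (f c, c) \<in> G"
        using bchoice[of "Range G" "\<lambda>c d. (d, c) \<in> G"] unfolding G(2) by blast
      have "f 0 = 0"
        using partial_field_isoD(7)[OF G(1) f] partial_field_isoD(2)[OF G(1)] by blast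
      then show ?thesis
        using f pG by (intro exI[of _ "map_poly f p'"]) (simp add: poly_rel_def coeff_map_poly)
    qed
    have dom: "\<forall>i. poly.coeff p i \<in> Domain G" "\<forall>i. poly.coeff p' i \<in> Domain G" if "poly_rel G p p'" for p p'
      using that G(2) by (auto simp: poly_rel_def)
    have "Domain H = Range H"
    proof (intro equalityI subsetI)
      fix u assume "u \<in> Domain H"
      then obtain p p' r r' where *: "u = poly p x / poly r x" "poly_rel G p p'" "poly_rel G r r'"
        "poly r x \<noteq> 0" unfolding H_def by blast
      obtain s t where s: "poly_rel G s p" "poly_rel G t r" using left dom * by metis
      then have "poly t x \<noteq> 0" using xx * by blast
      with s have "(poly s x / poly t x, poly p x / poly r x) \<in> H" unfolding H_def by blast
      then show "u \<in> Range H" using * by blast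
    next
      fix u assume "u \<in> Range H"
      then obtain p p' r r' where *: "u = poly p' x / poly r' x" "poly_rel G p p'" "poly_rel G r r'"
        "poly r x \<noteq> 0" unfolding H_def by blast
      obtain s t where s: "poly_rel G p' s" "poly_rel G r' t" using right dom * by metis
      have "poly r' x \<noteq> 0" using xx * by blast
      with s have "(poly p' x / poly r' x, poly s x / poly t x) \<in> H" unfolding H_def by blast
      then show "u \<in> Domain H" using * by blast
    qed
    \<comment> \<open>Maximality puts x itself into the domain, where the linear polynomial with
      root x contradicts transcendence.\<close>
    then have "H = G" using maxG[of H] H G(3) by (auto simp: \<F>_def)
    then have x: "x \<in> Domain G" using H(3) by blast
    have "\<forall>i. poly.coeff [:- x, 1:] i \<in> Domain G"
    proof
      fix i
      obtain x' where "(x, x') \<in> G" using x by blast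
      then have "(- x, - x') \<in> G"
        using partial_field_isoD(3)[OF G(1) partial_field_isoD(2)[OF G(1)]] by force
      then show "poly.coeff [:- x, 1:] i \<in> Domain G"
        using partial_field_isoD(1,2)[OF G(1)] by (auto simp: coeff_pCons split: nat.split)
    qed
    moreover have "[:- x, 1:] \<noteq> 0" "poly [:- x, 1:] x = 0" by simp_all
    ultimately show False using no by blast
  qed

  define \<E> where "\<E> = {H. partial_field_iso H \<and> G \<subseteq> H}"
  have "\<exists>H\<in>\<E>. \<forall>Y\<in>\<E>. H \<subseteq> Y \<longrightarrow> Y = H"
  proof (rule subset_Zorn_nonempty)
    show "\<E> \<noteq> {}" using G by (auto simp: \<E>_def)
    fix \<C> assume c: "\<C> \<noteq> {}" "subset.chain \<E> \<C>"
    then have sub: "\<C> \<subseteq> \<E>" by (simp add: subset_chain_def)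
    then have "partial_field_iso (\<Union>\<C>)"
      by (intro partial_field_iso_Union[OF _ c]) (auto simp: \<E>_def)
    moreover have "G \<subseteq> \<Union>\<C>"
    proof -
      obtain S where "S \<in> \<C>" using c(1) by blast
      with subsetD[OF sub this] show ?thesis by (auto simp: \<E>_def)
    qed
    ultimately show "\<Union>\<C> \<in> \<E>" by (simp add: \<E>_def)
  qed
  then obtain H where "H \<in> \<E>" and max: "\<And>Y. Y \<in> \<E> \<Longrightarrow> H \<subseteq> Y \<Longrightarrow> Y = H"
    by metis
  then have H: "partial_field_iso H" "G \<subseteq> H" by (simp_all add: \<E>_def)
  have maxH: "Y = H" if "partial_field_iso Y" "H \<subseteq> Y" for Y
    using max[of Y] that H(2) by (simp add: \<E>_def)
  have dom: "x \<in> Domain H" for x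
  proof -
    obtain p where p: "p \<noteq> 0" "\<forall>i. poly.coeff p i \<in> Domain G" "poly p x = 0"
      using alg[of x] by (elim exE conjE)
    have coeff: "poly.coeff p i \<in> Domain H" for i
      using p(2) Domain_mono[OF H(2)] by (meson subsetD)
    obtain K y where K: "partial_field_iso K" "H \<subseteq> K" "(x, y) \<in> K"
      using algebraic_extension[OF H(1) p(1) coeff p(3)] by (elim exE conjE)
    then show ?thesis using maxH[OF K(1,2)] by blast
  qed
  have ran: "x \<in> Range H" for x
  proof -
    obtain p where p: "p \<noteq> 0" "\<forall>i. poly.coeff p i \<in> Domain G" "poly p x = 0"
      using alg[of x] by (elim exE conjE)
    \<comment> \<open>Surjectivity is totality of the converse: the domain of \<open>G\<close> is
      also its range, so every x is algebraic over the range of \<open>H\<close> as well.\<close>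
    have coeff: "poly.coeff p i \<in> Domain (H\<inverse>)" for i
      using p(2) Range_mono[OF H(2)] unfolding Domain_converse G(2) by (meson subsetD)
    obtain K y where K: "partial_field_iso K" "H\<inverse> \<subseteq> K" "(x, y) \<in> K"
      using algebraic_extension[OF partial_field_iso_converse[OF H(1)] p(1) coeff p(3)] by (elim exE conjE)
    then have "K\<inverse> = H"
      by (intro maxH partial_field_iso_converse) auto
    then show ?thesis using K by blast
  qed
  define \<sigma> where "\<sigma> = (\<lambda>x. THE y. (x, y) \<in> H)"
  have \<sigma>I: "\<sigma> x = y" if "(x, y) \<in> H" for x y
    unfolding \<sigma>_def using that partial_field_iso_fun[OF H(1)] by blast
  have \<sigma>: "(x, \<sigma> x) \<in> H" for x using dom[of x] \<sigma>I by blast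
  have "inj \<sigma>"
  proof (rule injI)
    fix x y assume eq: "\<sigma> x = \<sigma> y"
    have "(\<sigma> x, x) \<in> H\<inverse>" "(\<sigma> x, y) \<in> H\<inverse>" using \<sigma>[of x] \<sigma>[of y] by (auto simp: eq)
    then show "x = y" by (rule partial_field_iso_fun[OF partial_field_iso_converse[OF H(1)]])
  qed
  moreover have "surj \<sigma>" using ran \<sigma>I by (metis RangeE surjI surj_def)
  ultimately have bij: "bij \<sigma>" by (simp add: bij_def)
  have hom: "\<sigma> (x + y) = \<sigma> x + \<sigma> y" "\<sigma> (x * y) = \<sigma> x * \<sigma> y" for x y
    by (intro \<sigma>I partial_field_isoD[OF H(1)] \<sigma>)+
  have "\<sigma> x = y" if "(x, y) \<in> G0" for x y
    by (rule \<sigma>I) (use that G(3) H(2) in blast)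
  with bij hom show ?thesis by (rule that)
qed


section \<open>Invertible matrices\<close>

definition GL_mat :: "nat \<Rightarrow> complex mat set" where
  "GL_mat n = {A. A \<in> carrier_mat n n \<and> invertible_mat A}"

text \<open>A one-sided inverse of a square matrix is two-sided. The matrix is then a unit of the
  matrix ring, so \<open>mat_inverse\<close> cannot return \<open>None\<close>, and uniqueness of
  inverses identifies its value.\<close>

lemma GL_matI:
  assumes "A \<in> carrier_mat n n" "B \<in> carrier_mat n n" "A * B = 1\<^sub>m n"
  shows "A \<in> GL_mat n" "matrix_inverse A = B"
proof -
  have BA: "B * A = 1\<^sub>m n" by (rule mat_mult_left_right_inverse[OF assms])
  then show "A \<in> GL_mat n"
    using assms unfolding GL_mat_def invertible_mat_def inverts_mat_def by auto
  show "matrix_inverse A = B"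
  proof (cases "mat_inverse A")
    case None
    have "A \<in> Units (ring_mat TYPE(complex) n undefined)"
      using assms BA unfolding Units_def by (auto simp: ring_mat_simps)
    then show ?thesis using mat_inverse(1)[OF assms(1) None, of undefined] by blast
  next
    case (Some D)
    from mat_inverse(2)[OF assms(1) this] have D: "D * A = 1\<^sub>m n" "D \<in> carrier_mat n n" by auto
    have "D = D * (A * B)" using assms D by simp
    also have "\<dots> = (D * A) * B" by (rule assoc_mult_mat[symmetric]) (use D assms in auto)
    also have "\<dots> = B" using D assms by simp
    finally show ?thesis using Some by simp
  qed
qed

lemma GL_matD:
  assumes "A \<in> GL_mat n"
  shows "A \<in> carrier_mat n n" "matrix_inverse A \<in> carrier_mat n n"
    "A * matrix_inverse A = 1\<^sub>m n" "matrix_inverse A * A = 1\<^sub>m n"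
proof -
  show A: "A \<in> carrier_mat n n" using assms by (simp add: GL_mat_def)
  obtain B where B: "A * B = 1\<^sub>m n" "B * A = 1\<^sub>m (dim_row B)"
    using assms A unfolding GL_mat_def invertible_mat_def inverts_mat_def by auto
  have "dim_col B = n" using arg_cong[OF B(1), of dim_col] by simp
  moreover have "dim_row B = n" using arg_cong[OF B(2), of dim_col] A by simp
  ultimately have Bc: "B \<in> carrier_mat n n" by auto
  then have "matrix_inverse A = B" using GL_matI[OF A _ B(1)] by simp
  then show "matrix_inverse A \<in> carrier_mat n n" "A * matrix_inverse A = 1\<^sub>m n"
    "matrix_inverse A * A = 1\<^sub>m n"
    using B Bc by auto
qed

lemma GL_mat_one: "1\<^sub>m n \<in> GL_mat n" "matrix_inverse (1\<^sub>m n) = 1\<^sub>m n"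
  by (rule GL_matI[of _ n "1\<^sub>m n"]; simp)+

lemma GL_mat_inverse:
  assumes "A \<in> GL_mat n"
  shows "matrix_inverse A \<in> GL_mat n" "matrix_inverse (matrix_inverse A) = A"
  by (rule GL_matI[of _ n A]; use GL_matD[OF assms] in simp)+

lemma GL_mat_mult:
  assumes "A \<in> GL_mat n" "B \<in> GL_mat n"
  shows "A * B \<in> GL_mat n" "matrix_inverse (A * B) = matrix_inverse B * matrix_inverse A"
proof -
  note A = GL_matD[OF assms(1)] and B = GL_matD[OF assms(2)]
  have "(A * B) * (matrix_inverse B * matrix_inverse A)
      = A * (B * (matrix_inverse B * matrix_inverse A))"
    by (rule assoc_mult_mat) (use A B in auto)
  also have "B * (matrix_inverse B * matrix_inverse A) = (B * matrix_inverse B) * matrix_inverse A"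
    by (rule assoc_mult_mat[symmetric]) (use A B in auto)
  also have "A * ((B * matrix_inverse B) * matrix_inverse A) = 1\<^sub>m n"
    using A B by simp
  finally have *: "(A * B) * (matrix_inverse B * matrix_inverse A) = 1\<^sub>m n" .
  show "A * B \<in> GL_mat n" "matrix_inverse (A * B) = matrix_inverse B * matrix_inverse A"
    by (rule GL_matI[OF _ _ *]; use A B in auto)+
qed

lemma GL_mat_smult:
  assumes "c \<noteq> 0"
  shows "c \<cdot>\<^sub>m 1\<^sub>m n \<in> GL_mat n" "matrix_inverse (c \<cdot>\<^sub>m 1\<^sub>m n) = inverse c \<cdot>\<^sub>m 1\<^sub>m n"
proof -
  have *: "(c \<cdot>\<^sub>m 1\<^sub>m n) * (inverse c \<cdot>\<^sub>m 1\<^sub>m n) = 1\<^sub>m n"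
    using assms by (intro eq_matI) (auto simp: mult_smult_assoc_mat[of _ n n] mult_smult_distrib[of _ n n])
  show "c \<cdot>\<^sub>m 1\<^sub>m n \<in> GL_mat n" "matrix_inverse (c \<cdot>\<^sub>m 1\<^sub>m n) = inverse c \<cdot>\<^sub>m 1\<^sub>m n"
    by (rule GL_matI[OF _ _ *]; simp)+
qed

lemma smult_one_mult:
  fixes c :: complex
  assumes "A \<in> carrier_mat n n"
  shows "(c \<cdot>\<^sub>m 1\<^sub>m n) * A = c \<cdot>\<^sub>m A" "A * (c \<cdot>\<^sub>m 1\<^sub>m n) = c \<cdot>\<^sub>m A"
  using assms mult_smult_assoc_mat[of "1\<^sub>m n" n n A n c] mult_smult_distrib[of A n n "1\<^sub>m n" n c]
  by simp_all

lemma conjugate_mult_cancel: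
  assumes "A \<in> GL_mat n" "B \<in> GL_mat m" "R \<in> carrier_mat n m"
  shows "matrix_inverse A * (A * R * matrix_inverse B) * B = R"
proof -
  note A = GL_matD[OF assms(1)] and B = GL_matD[OF assms(2)]
  have "A * R * matrix_inverse B * B = A * R * (matrix_inverse B * B)"
    by (rule assoc_mult_mat) (use A B assms(3) in auto)
  also have "\<dots> = A * R" using A B assms(3) by simp
  finally have "matrix_inverse A * (A * R * matrix_inverse B) * B = matrix_inverse A * (A * R)"
    using A B assms(3) assoc_mult_mat[of "matrix_inverse A" n n "A * R * matrix_inverse B" m B m] by simp
  also have "\<dots> = (matrix_inverse A * A) * R"
    by (rule assoc_mult_mat[symmetric]) (use A B assms(3) in auto)
  finally show ?thesis using A B assms(3) by simp
qed

lemma conjugate_mult_mult: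
  assumes "A \<in> GL_mat n" "A' \<in> GL_mat n" "B \<in> GL_mat m" "B' \<in> GL_mat m" "R \<in> carrier_mat n m"
  shows "A * (A' * R * matrix_inverse B') * matrix_inverse B = A * A' * R * matrix_inverse (B * B')"
proof -
  note A = GL_matD[OF assms(1)] GL_matD[OF assms(2)] and B = GL_matD[OF assms(3)] GL_matD[OF assms(4)]
  show ?thesis
    using A B assms(5)
    by (simp add: GL_mat_mult(2)[OF assms(3,4)] assoc_mult_mat[of _ n n _ m _ m]
        assoc_mult_mat[of _ n m _ m _ m] assoc_mult_mat[of _ n n _ n _ m])
qed

section \<open>Unitary matrices\<close>

lemma unitary_mat_GL:
  assumes "A \<in> GL_mat n"
  shows "unitary_mat A \<longleftrightarrow> matrix_inverse A = mat_adjoint A"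
proof -
  note A = GL_matD[OF assms]
  have adj: "mat_adjoint A \<in> carrier_mat n n"
    using A(1) by (auto simp: mat_adjoint_def)
  show ?thesis
  proof
    assume "unitary_mat A"
    then have "A * mat_adjoint A = 1\<^sub>m n" using A(1) by (simp add: unitary_mat_def inverts_mat_def)
    then show "matrix_inverse A = mat_adjoint A" using GL_matI(2)[OF A(1) adj] by simp
  next
    assume *: "matrix_inverse A = mat_adjoint A"
    show "unitary_mat A"
      using A adj unfolding unitary_mat_def inverts_mat_def * by auto
  qed
qed

lemma mat_adjoint_index:
  fixes A :: "complex mat"
  assumes "A \<in> carrier_mat n n" "i < n" "j < n"
  shows "mat_adjoint A $$ (i, j) = cnj (A $$ (j, i))"
  using assms by (simp add: mat_adjoint_def mat_of_rows_index)

lemma mat_adjoint_carrier: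
  fixes A :: "complex mat"
  shows "A \<in> carrier_mat n n \<Longrightarrow> mat_adjoint A \<in> carrier_mat n n"
  by (auto simp: mat_adjoint_def)

lemma mat_adjoint_mult:
  fixes A B :: "complex mat"
  assumes "A \<in> carrier_mat n n" "B \<in> carrier_mat n n"
  shows "mat_adjoint (A * B) = mat_adjoint B * mat_adjoint A"
proof (rule eq_matI)
  have AB: "A * B \<in> carrier_mat n n" using assms by simp
  note adj = mat_adjoint_carrier[OF assms(1)] mat_adjoint_carrier[OF assms(2)]
  fix i j assume "i < dim_row (mat_adjoint B * mat_adjoint A)" "j < dim_col (mat_adjoint B * mat_adjoint A)"
  then have ij: "i < n" "j < n" using adj by auto
  then show "mat_adjoint (A * B) $$ (i, j) = (mat_adjoint B * mat_adjoint A) $$ (i, j)"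
    using assms adj by (simp add: mat_adjoint_index[OF AB] scalar_prod_def mat_adjoint_index[of _ n]
        row_def col_def mult.commute)
qed (use assms in \<open>auto simp: mat_adjoint_def\<close>)

lemma mat_adjoint_adjoint:
  fixes A :: "complex mat"
  assumes "A \<in> carrier_mat n n"
  shows "mat_adjoint (mat_adjoint A) = A"
  using assms mat_adjoint_carrier[OF assms] mat_adjoint_carrier[OF mat_adjoint_carrier[OF assms]]
  by (intro eq_matI) (auto simp: mat_adjoint_index[of _ n])

lemma unitary_mat_one: "unitary_mat (1\<^sub>m n)"
proof -
  have "mat_adjoint (1\<^sub>m n :: complex mat) = 1\<^sub>m n"
    using mat_adjoint_carrier[of "1\<^sub>m n" n] by (intro eq_matI) (auto simp: mat_adjoint_index[of _ n])
  then show ?thesis by (simp add: unitary_mat_GL[OF GL_mat_one(1)] GL_mat_one(2))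
qed

lemma unitary_mat_mult:
  assumes "A \<in> GL_mat n" "B \<in> GL_mat n" "unitary_mat A" "unitary_mat B"
  shows "unitary_mat (A * B)"
  using assms
  by (simp add: unitary_mat_GL[of _ n] GL_mat_mult[of _ n] mat_adjoint_mult[of A n B] GL_matD(1)[of _ n])

lemma unitary_mat_inverse:
  assumes "A \<in> GL_mat n" "unitary_mat A"
  shows "unitary_mat (matrix_inverse A)"
proof -
  have "matrix_inverse A = mat_adjoint A" using assms by (simp add: unitary_mat_GL[of _ n])
  then show ?thesis
    using GL_mat_inverse[OF assms(1)] GL_matD(1)[OF assms(1)]
    by (simp add: unitary_mat_GL[of _ n] mat_adjoint_adjoint[of _ n])
qed

text \<open>The alternative \<open>n = 0\<close> is the case of a vanishing fusion space: every
  scalar gives the empty matrix, which is unitary.\<close>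

lemma unitary_mat_smult_one:
  "unitary_mat (c \<cdot>\<^sub>m 1\<^sub>m n) \<longleftrightarrow> n = 0 \<or> cmod c = 1"
proof -
  have adj: "mat_adjoint (c \<cdot>\<^sub>m 1\<^sub>m n) = cnj c \<cdot>\<^sub>m 1\<^sub>m n"
    using mat_adjoint_carrier[of "c \<cdot>\<^sub>m 1\<^sub>m n" n]
    by (intro eq_matI) (auto simp: mat_adjoint_index[of _ n])
  have prod: "(x \<cdot>\<^sub>m 1\<^sub>m n) * (y \<cdot>\<^sub>m 1\<^sub>m n) = (x * y) \<cdot>\<^sub>m 1\<^sub>m n" for x y :: complex
    by (subst smult_one_mult(1)[of _ n]) (auto intro!: eq_matI)
  have one: "x \<cdot>\<^sub>m 1\<^sub>m n = 1\<^sub>m n \<longleftrightarrow> n = 0 \<or> x = 1" for x :: complex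
    by (auto simp: mat_eq_iff)
  have "cmod c = 1 \<longleftrightarrow> c * cnj c = 1"
  proof -
    have "c * cnj c = of_real ((cmod c)\<^sup>2)" by (simp only: complex_norm_square)
    also have "\<dots> = 1 \<longleftrightarrow> (cmod c)\<^sup>2 = 1" by (metis of_real_1 of_real_eq_iff)
    also have "\<dots> \<longleftrightarrow> cmod c = 1" using norm_ge_zero[of c] unfolding power2_eq_1_iff by linarith
    finally show ?thesis by simp
  qed
  then show ?thesis
    by (auto simp: unitary_mat_def inverts_mat_def adj prod one mult.commute[of "cnj c"])
qed


section \<open>Transport of structure\<close>

text \<open>With one sum over a product set, two fourfold sums can be interchanged in a single
  step.\<close>

lemma sum_lessThan4:
  fixes f :: "nat \<Rightarrow> nat \<Rightarrow> nat \<Rightarrow> nat \<Rightarrow> complex"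
  shows "(\<Sum>i<n1. \<Sum>j<n2. \<Sum>k<n3. \<Sum>l<n4. f i j k l) =
    (\<Sum>(i, j, k, l)\<in>{..<n1} \<times> {..<n2} \<times> {..<n3} \<times> {..<n4}. f i j k l)"
  by (simp add: sum.cartesian_product split_def)

lemma prod_of_sums4:
  fixes f1 f2 f3 f4 :: "nat \<Rightarrow> complex"
  shows "(\<Sum>i<n1. \<Sum>j<n2. \<Sum>k<n3. \<Sum>l<n4. f1 i * f2 j * f3 k * f4 l) =
    (\<Sum>i<n1. f1 i) * (\<Sum>i<n2. f2 i) * (\<Sum>i<n3. f3 i) * (\<Sum>i<n4. f4 i)"
  by (simp add: sum_distrib_left[symmetric] sum_distrib_right[symmetric])

text \<open>After interchanging the sums, the inner one factors into four matrix products. Upper and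
  lower indices of F are multiplied from opposite sides, hence \<open>A * A'\<close> and
  \<open>B * B'\<close>, but \<open>P' * P\<close> and \<open>Q' * Q\<close>.\<close>

lemma change_of_bases_mult:
  fixes A A' B B' P P' Q Q' :: "complex mat"
  assumes A: "A \<in> carrier_mat n1 n1" "A' \<in> carrier_mat n1 n1" "i < n1"
    and B: "B \<in> carrier_mat n2 n2" "B' \<in> carrier_mat n2 n2" "j < n2"
    and P: "P \<in> carrier_mat n3 n3" "P' \<in> carrier_mat n3 n3" "k < n3"
    and Q: "Q \<in> carrier_mat n4 n4" "Q' \<in> carrier_mat n4 n4" "l < n4"
  shows "(\<Sum>i'<n1. \<Sum>j'<n2. \<Sum>k'<n3. \<Sum>l'<n4. A $$ (i, i') * B $$ (j, j') *
      (\<Sum>i''<n1. \<Sum>j''<n2. \<Sum>k''<n3. \<Sum>l''<n4. A' $$ (i', i'') * B' $$ (j', j'') *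
         F i'' j'' k'' l'' * P' $$ (k'', k') * Q' $$ (l'', l')) * P $$ (k', k) * Q $$ (l', l)) =
    (\<Sum>i''<n1. \<Sum>j''<n2. \<Sum>k''<n3. \<Sum>l''<n4. (A * A') $$ (i, i'') * (B * B') $$ (j, j'') *
         F i'' j'' k'' l'' * (P' * P) $$ (k'', k) * (Q' * Q) $$ (l'', l))"
    (is "?L = ?R")
proof -
  let ?I = "{..<n1} \<times> {..<n2} \<times> {..<n3} \<times> {..<n4}"
  have "?L = (\<Sum>(i', j', k', l')\<in>?I. \<Sum>(i'', j'', k'', l'')\<in>?I. F i'' j'' k'' l'' *
      ((A $$ (i, i') * A' $$ (i', i'')) * (B $$ (j, j') * B' $$ (j', j'')) *
       (P' $$ (k'', k') * P $$ (k', k)) * (Q' $$ (l'', l') * Q $$ (l', l))))"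
    unfolding sum_lessThan4
    by (intro sum.cong refl) (auto simp: sum_distrib_left sum_distrib_right split_def intro!: sum.cong)
  also have "\<dots> = (\<Sum>(i'', j'', k'', l'')\<in>?I. F i'' j'' k'' l'' * (\<Sum>(i', j', k', l')\<in>?I.
      ((A $$ (i, i') * A' $$ (i', i'')) * (B $$ (j, j') * B' $$ (j', j'')) *
       (P' $$ (k'', k') * P $$ (k', k)) * (Q' $$ (l'', l') * Q $$ (l', l)))))"
    unfolding split_def by (subst sum.swap) (simp add: sum_distrib_left)
  also have "\<dots> = ?R"
    unfolding sum_lessThan4[symmetric] prod_of_sums4
    using assms by (intro sum.cong refl) (auto simp: scalar_prod_def atLeast0LessThan)
  finally show ?thesis .
qed

lemma change_of_bases_one:
  assumes "i < n1" "j < n2" "k < n3" "l < n4"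
  shows "(\<Sum>i'<n1. \<Sum>j'<n2. \<Sum>k'<n3. \<Sum>l'<n4. (1\<^sub>m n1 :: complex mat) $$ (i, i') * 1\<^sub>m n2 $$ (j, j') *
      F i' j' k' l' * 1\<^sub>m n3 $$ (k', k) * 1\<^sub>m n4 $$ (l', l)) = F i j k l"
proof -
  have "(\<Sum>i'<n1. \<Sum>j'<n2. \<Sum>k'<n3. \<Sum>l'<n4. (1\<^sub>m n1 :: complex mat) $$ (i, i') * 1\<^sub>m n2 $$ (j, j') *
      F i' j' k' l' * 1\<^sub>m n3 $$ (k', k) * 1\<^sub>m n4 $$ (l', l)) =
    (\<Sum>i'<n1. \<Sum>j'<n2. \<Sum>k'<n3. \<Sum>l'<n4. if l' = l then if k' = k then if j' = j then
       if i' = i then F i' j' k' l' else 0 else 0 else 0 else 0)"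
    by (intro sum.cong refl) (use assms in auto)
  also have "\<dots> = F i j k l"
    using assms by (simp add: sum.delta)
  finally show ?thesis .
qed

text \<open>
  For \<open>s = (g, U)\<close>, the map \<open>g\<close> goes from the anyons of \<open>C'\<close> to those of \<open>C\<close>, and \<open>C'\<close> is read off
  \<open>C\<close> in the bases $|a,b,c;\mu\rangle' = \sum_{\mu'} U(g(a),g(b),g(c))_{\mu\mu'}
  |g(a),g(b),g(c);\mu'\rangle$.  Symmetries (\<open>C' = C\<close>) and changes of gauge (\<open>g = id\<close>) are both of
  this form.
\<close>

definition transports :: "('a::finite) mtc_data \<Rightarrow> 'a symmetry \<Rightarrow> 'a mtc_data \<Rightarrow> bool" where
  "transports C s C' \<longleftrightarrow> (case s of (g, U) \<Rightarrow>
     bij g \<and> (\<forall>a b c. fus C (g a) (g b) (g c) = fus C' a b c) \<and>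
     (\<forall>a b c. U a b c \<in> GL_mat (fus C a b c)) \<and>
     (\<forall>a b c. U (g b) (g a) (g c) * Rsym C (g a) (g b) (g c) * matrix_inverse (U (g a) (g b) (g c))
        = Rsym C' a b c) \<and>
     (\<forall>a b c d e f \<alpha> \<beta> \<mu> \<nu>.
        \<alpha> < fus C' a b e \<longrightarrow> \<beta> < fus C' e c d \<longrightarrow> \<mu> < fus C' b c f \<longrightarrow> \<nu> < fus C' a f d \<longrightarrow>
        (\<Sum>\<alpha>'<fus C' a b e. \<Sum>\<beta>'<fus C' e c d. \<Sum>\<mu>'<fus C' b c f. \<Sum>\<nu>'<fus C' a f d.
           U (g a) (g b) (g e) $$ (\<alpha>, \<alpha>') * U (g e) (g c) (g d) $$ (\<beta>, \<beta>') *
           Fsym C (g a) (g b) (g c) (g d) (g e, \<alpha>', \<beta>') (g f, \<mu>', \<nu>') *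
           matrix_inverse (U (g b) (g c) (g f)) $$ (\<mu>', \<mu>) *
           matrix_inverse (U (g a) (g f) (g d)) $$ (\<nu>', \<nu>))
        = Fsym C' a b c d (e, \<alpha>, \<beta>) (f, \<mu>, \<nu>)))"

lemma linear_symmetries_iff: "s \<in> linear_symmetries C \<longleftrightarrow> transports C s C"
  by (cases s) (simp only: linear_symmetries_def transports_def GL_mat_def left_index_def
      right_index_def mem_Collect_eq case_prod_conv imp_conjL)

lemma gauge_equivalent_transports:
  assumes "gauge_equivalent C C'"
  obtains \<Gamma> where "transports C (id, \<Gamma>) C'"
proof -
  obtain \<Gamma> where "fus C' = fus C"
    and "\<forall>a b c. \<Gamma> a b c \<in> carrier_mat (fus C a b c) (fus C a b c) \<and> invertible_mat (\<Gamma> a b c)"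
    and "\<forall>a b c. Rsym C' a b c = \<Gamma> b a c * Rsym C a b c * matrix_inverse (\<Gamma> a b c)"
    and "\<forall>a b c d e f \<alpha> \<beta> \<mu> \<nu>.
          (e, \<alpha>, \<beta>) \<in> left_index C a b c d \<longrightarrow> (f, \<mu>, \<nu>) \<in> right_index C a b c d \<longrightarrow>
          Fsym C' a b c d (e, \<alpha>, \<beta>) (f, \<mu>, \<nu>) =
          (\<Sum>\<alpha>'<fus C a b e. \<Sum>\<beta>'<fus C e c d. \<Sum>\<mu>'<fus C b c f. \<Sum>\<nu>'<fus C a f d.
             \<Gamma> a b e $$ (\<alpha>, \<alpha>') * \<Gamma> e c d $$ (\<beta>, \<beta>') *
             Fsym C a b c d (e, \<alpha>', \<beta>') (f, \<mu>', \<nu>') *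
             matrix_inverse (\<Gamma> b c f) $$ (\<mu>', \<mu>) * matrix_inverse (\<Gamma> a f d) $$ (\<nu>', \<nu>))"
    using assms unfolding gauge_equivalent_def by (elim exE conjE) rule
  then have "transports C (id, \<Gamma>) C'"
    by (simp add: transports_def GL_mat_def left_index_def right_index_def)
  then show ?thesis by (rule that)
qed

lemma transportsD:
  assumes "transports C (g, U) C'"
  shows "bij g" "fus C (g a) (g b) (g c) = fus C' a b c" "U a b c \<in> GL_mat (fus C a b c)"
    "U (g a) (g b) (g c) \<in> GL_mat (fus C' a b c)"
    "Rsym C' a b c = U (g b) (g a) (g c) * Rsym C (g a) (g b) (g c) * matrix_inverse (U (g a) (g b) (g c))"
    "\<alpha> < fus C' a b e \<Longrightarrow> \<beta> < fus C' e c d \<Longrightarrow> \<mu> < fus C' b c f \<Longrightarrow> \<nu> < fus C' a f d \<Longrightarrow>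
     Fsym C' a b c d (e, \<alpha>, \<beta>) (f, \<mu>, \<nu>) =
       (\<Sum>\<alpha>'<fus C' a b e. \<Sum>\<beta>'<fus C' e c d. \<Sum>\<mu>'<fus C' b c f. \<Sum>\<nu>'<fus C' a f d.
           U (g a) (g b) (g e) $$ (\<alpha>, \<alpha>') * U (g e) (g c) (g d) $$ (\<beta>, \<beta>') *
           Fsym C (g a) (g b) (g c) (g d) (g e, \<alpha>', \<beta>') (g f, \<mu>', \<nu>') *
           matrix_inverse (U (g b) (g c) (g f)) $$ (\<mu>', \<mu>) *
           matrix_inverse (U (g a) (g f) (g d)) $$ (\<nu>', \<nu>))"
proof -
  show "bij g" and f: "\<And>a b c. fus C (g a) (g b) (g c) = fus C' a b c"
    and U: "\<And>a b c. U a b c \<in> GL_mat (fus C a b c)"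
    and "Rsym C' a b c = U (g b) (g a) (g c) * Rsym C (g a) (g b) (g c) * matrix_inverse (U (g a) (g b) (g c))"
    using assms by (simp_all add: transports_def)
  show "U (g a) (g b) (g c) \<in> GL_mat (fus C' a b c)" using U[of "g a" "g b" "g c"] f by simp
qed (use assms in \<open>simp add: transports_def\<close>)

text \<open>Fixes the dimensions that associativity and cancellation in products with R require. The
  property passes along transports and Galois conjugation, so it is available for every presentation
  that occurs.\<close>

definition R_shaped :: "'a mtc_data \<Rightarrow> bool" where
  "R_shaped C \<longleftrightarrow> (\<forall>a b c. Rsym C a b c \<in> carrier_mat (fus C b a c) (fus C a b c))"

lemma R_shaped_transports:
  assumes "transports C s C'" "R_shaped C"
  shows "R_shaped C'"
proof (cases s)
  case (Pair g U)
  note T = transportsD[OF assms(1)[unfolded Pair]]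
  show ?thesis
    unfolding R_shaped_def T(5)
    using T(2) GL_matD(1,2)[OF T(4)] assms(2)[unfolded R_shaped_def] by (metis mult_carrier_mat)
qed

text \<open>Expanding the basis of \<open>C''\<close> in that of \<open>C'\<close> and then in that
  of \<open>C\<close> gives \<open>U (g a) (g b) (g c) * V (h (g a)) (h (g b)) (h (g c))\<close>.
  The anyon maps run from the new presentation to the old one, so the second transport is the factor
  that acts first in \<open>compose_symmetry\<close>.\<close>

lemma transports_compose:
  assumes "transports C s C'" "transports C' t C''" "R_shaped C"
  shows "transports C (compose_symmetry s t) C''"
proof (cases s; cases t)
  fix h V g U
  assume s: "s = (h, V)" and t: "t = (g, U)"
  note T = transportsD[OF assms(1)[unfolded s]] and T' = transportsD[OF assms(2)[unfolded t]]
  have inv_h [simp]: "inv_into UNIV h (h x) = x" for x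
    using T(1) by (simp add: bij_is_inj)
  have h_inv [simp]: "h (inv_into UNIV h x) = x" for x
    using T(1) by (simp add: bij_is_surj surj_f_inv_f)
  have f: "fus C (h (g a)) (h (g b)) (h (g c)) = fus C'' a b c" for a b c
    by (simp add: T(2) T'(2))
  have V: "V (h (g a)) (h (g b)) (h (g c)) \<in> GL_mat (fus C'' a b c)" for a b c
    using T(4)[of "g a" "g b" "g c"] by (simp add: T'(2))
  have "U (inv_into UNIV h a) (inv_into UNIV h b) (inv_into UNIV h c) * V a b c \<in> GL_mat (fus C a b c)"
    for a b c
    using T'(3)[of "inv_into UNIV h a" "inv_into UNIV h b" "inv_into UNIV h c"] T(3)[of a b c]
    by (intro GL_mat_mult) (simp_all add: T(2)[symmetric])
  moreover have "U (g b) (g a) (g c) * V (h (g b)) (h (g a)) (h (g c)) *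
       Rsym C (h (g a)) (h (g b)) (h (g c)) *
       matrix_inverse (U (g a) (g b) (g c) * V (h (g a)) (h (g b)) (h (g c))) = Rsym C'' a b c" for a b c
  proof -
    have "Rsym C (h (g a)) (h (g b)) (h (g c)) \<in> carrier_mat (fus C'' b a c) (fus C'' a b c)"
      using assms(3) f unfolding R_shaped_def by metis
    then show ?thesis
      unfolding T'(5) T(5) by (rule conjugate_mult_mult[OF T'(4) V T'(4) V, symmetric])
  qed
  moreover have "(\<Sum>\<alpha>'<fus C'' a b e. \<Sum>\<beta>'<fus C'' e c d. \<Sum>\<mu>'<fus C'' b c f. \<Sum>\<nu>'<fus C'' a f d.
       (U (g a) (g b) (g e) * V (h (g a)) (h (g b)) (h (g e))) $$ (\<alpha>, \<alpha>') *
       (U (g e) (g c) (g d) * V (h (g e)) (h (g c)) (h (g d))) $$ (\<beta>, \<beta>') *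
       Fsym C (h (g a)) (h (g b)) (h (g c)) (h (g d)) (h (g e), \<alpha>', \<beta>') (h (g f), \<mu>', \<nu>') *
       matrix_inverse (U (g b) (g c) (g f) * V (h (g b)) (h (g c)) (h (g f))) $$ (\<mu>', \<mu>) *
       matrix_inverse (U (g a) (g f) (g d) * V (h (g a)) (h (g f)) (h (g d))) $$ (\<nu>', \<nu>)) =
       Fsym C'' a b c d (e, \<alpha>, \<beta>) (f, \<mu>, \<nu>)"
    if ind: "\<alpha> < fus C'' a b e" "\<beta> < fus C'' e c d" "\<mu> < fus C'' b c f" "\<nu> < fus C'' a f d"
    for a b c d e f \<alpha> \<beta> \<mu> \<nu>
  proof -
    note F = T(6)[of _ "g a" "g b" "g e" _ "g c" "g d" _ "g f", unfolded T'(2)]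
    show ?thesis
      unfolding T'(6)[OF ind] GL_mat_mult(2)[OF T'(4) V]
      by (subst change_of_bases_mult[symmetric])
         (use ind GL_matD(1,2)[OF T'(4)] GL_matD(1,2)[OF V] in \<open>auto intro!: sum.cong simp: F\<close>)
  qed
  ultimately show ?thesis
    using T(1) T'(1) f by (simp add: s t transports_def bij_comp)
qed

text \<open>The old basis expressed in the new one. Its matrices are indexed by anyons of the new
  presentation, whence the arguments \<open>g a\<close>, \<open>g b\<close>, \<open>g c\<close> of
  \<open>U\<close>.\<close>

definition inverse_symmetry :: "('a::finite) symmetry \<Rightarrow> 'a symmetry" where
  "inverse_symmetry s = (case s of (g, U) \<Rightarrow>
     (inv_into UNIV g, \<lambda>a b c. matrix_inverse (U (g a) (g b) (g c))))"

lemma transports_inverse: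
  assumes "transports C s C'" "R_shaped C"
  shows "transports C' (inverse_symmetry s) C"
proof (cases s)
  case (Pair g U)
  note T = transportsD[OF assms(1)[unfolded Pair]]
  define h where "h = inv_into UNIV g"
  have g_h [simp]: "g (h x) = x" for x
    using T(1) by (simp add: h_def bij_is_surj surj_f_inv_f)
  have bij_h: "bij h" unfolding h_def by (rule bij_imp_bij_inv[OF T(1)])
  have f: "fus C' (h a) (h b) (h c) = fus C a b c" for a b c
    by (simp add: T(2)[symmetric])
  have "matrix_inverse (U b a c) * Rsym C' (h a) (h b) (h c) * matrix_inverse (matrix_inverse (U a b c))
      = Rsym C a b c" for a b c
    unfolding T(5) g_h GL_mat_inverse(2)[OF T(3)]
    by (rule conjugate_mult_cancel[OF T(3) T(3)]) (use assms(2) in \<open>simp add: R_shaped_def\<close>)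
  moreover have "(\<Sum>\<alpha>'<fus C a b e. \<Sum>\<beta>'<fus C e c d. \<Sum>\<mu>'<fus C b c f. \<Sum>\<nu>'<fus C a f d.
       matrix_inverse (U a b e) $$ (\<alpha>, \<alpha>') * matrix_inverse (U e c d) $$ (\<beta>, \<beta>') *
       Fsym C' (h a) (h b) (h c) (h d) (h e, \<alpha>', \<beta>') (h f, \<mu>', \<nu>') *
       matrix_inverse (matrix_inverse (U b c f)) $$ (\<mu>', \<mu>) *
       matrix_inverse (matrix_inverse (U a f d)) $$ (\<nu>', \<nu>)) =
       Fsym C a b c d (e, \<alpha>, \<beta>) (f, \<mu>, \<nu>)"
    (is "?L = ?R")
    if ind: "\<alpha> < fus C a b e" "\<beta> < fus C e c d" "\<mu> < fus C b c f" "\<nu> < fus C a f d"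
    for a b c d e f \<alpha> \<beta> \<mu> \<nu>
  proof -
    note F = T(6)[of _ "h a" "h b" "h e" _ "h c" "h d" _ "h f", unfolded f g_h]
    have "?L = (\<Sum>\<alpha>'<fus C a b e. \<Sum>\<beta>'<fus C e c d. \<Sum>\<mu>'<fus C b c f. \<Sum>\<nu>'<fus C a f d.
       1\<^sub>m (fus C a b e) $$ (\<alpha>, \<alpha>') * 1\<^sub>m (fus C e c d) $$ (\<beta>, \<beta>') *
       Fsym C a b c d (e, \<alpha>', \<beta>') (f, \<mu>', \<nu>') *
       1\<^sub>m (fus C b c f) $$ (\<mu>', \<mu>) * 1\<^sub>m (fus C a f d) $$ (\<nu>', \<nu>))"
      \<comment> \<open>Each identity matrix is rewritten as the inverse of \<open>U\<close> times
        \<open>U\<close>. This fits both sides: in the lower indices the new inverse precedes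
        \<open>U\<close>, in the upper ones the old inverse precedes the double inverse.\<close>
      unfolding GL_mat_inverse(2)[OF T(3)] GL_matD(4)[OF T(3), symmetric]
      by (subst change_of_bases_mult[symmetric])
         (use ind GL_matD(1,2)[OF T(3)] in \<open>auto intro!: sum.cong simp: F\<close>)
    also have "\<dots> = ?R"
      by (rule change_of_bases_one[OF ind, of "\<lambda>\<alpha>' \<beta>' \<mu>' \<nu>'. Fsym C a b c d (e, \<alpha>', \<beta>') (f, \<mu>', \<nu>')"])
    finally show ?thesis .
  qed
  ultimately show ?thesis
    using bij_h f GL_mat_inverse(1)[OF T(4)]
    by (simp add: Pair inverse_symmetry_def transports_def flip: h_def)
qed

section \<open>Groupoid laws for transports\<close>

definition identity_symmetry :: "'a mtc_data \<Rightarrow> 'a symmetry" where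
  "identity_symmetry C = (id, \<lambda>a b c. 1\<^sub>m (fus C a b c))"

text \<open>\<open>C'\<close> may differ from \<open>C\<close> in the values of \<open>Fsym\<close>
  outside the index ranges. The identity arrow thus also links presentations that agree only where
  their data are meaningful.\<close>

lemma transports_identity:
  assumes "R_shaped C" "fus C' = fus C" "Rsym C' = Rsym C"
    and "\<And>a b c d i j. i \<in> left_index C a b c d \<Longrightarrow> j \<in> right_index C a b c d \<Longrightarrow>
      Fsym C' a b c d i j = Fsym C a b c d i j"
  shows "transports C (identity_symmetry C) C'"
proof -
  have "1\<^sub>m (fus C b a c) * Rsym C a b c * 1\<^sub>m (fus C a b c) = Rsym C a b c" for a b c
    using assms(1) unfolding R_shaped_def by (metis left_mult_one_mat right_mult_one_mat)
  then show ?thesis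
    using assms(2-4) GL_mat_one(1)
      change_of_bases_one[where F = "\<lambda>\<alpha>' \<beta>' \<mu>' \<nu>'. Fsym C _ _ _ _ (_, \<alpha>', \<beta>') (_, \<mu>', \<nu>')"]
    by (simp add: transports_def identity_symmetry_def GL_mat_one(2) left_index_def right_index_def)
qed

text \<open>Matrix products are associative only for matching dimensions; composability of the three
  arrows supplies square matrices of a common size at every triple.\<close>

lemma compose_symmetry_assoc:
  assumes "transports C u C1" "transports C1 t C2" "transports C2 s C3"
  shows "compose_symmetry (compose_symmetry u t) s = compose_symmetry u (compose_symmetry t s)"
proof (cases u; cases t; cases s)
  fix k W h V g U
  assume e: "u = (k, W)" "t = (h, V)" "s = (g, U)"
  note u = transportsD[OF assms(1)[unfolded e]] and t = transportsD[OF assms(2)[unfolded e]]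
    and s = transportsD[OF assms(3)[unfolded e]]
  let ?k = "inv_into UNIV k" and ?h = "inv_into UNIV h"
  have k: "k (?k x) = x" for x using u(1) by (simp add: bij_is_surj surj_f_inv_f)
  have h: "h (?h x) = x" for x using t(1) by (simp add: bij_is_surj surj_f_inv_f)
  have kh: "inv_into UNIV (k \<circ> h) = ?h \<circ> ?k" using o_inv_distrib[OF u(1) t(1)] .
  have "U (?h (?k x)) (?h (?k y)) (?h (?k z)) * (V (?k x) (?k y) (?k z) * W x y z) =
        U (?h (?k x)) (?h (?k y)) (?h (?k z)) * V (?k x) (?k y) (?k z) * W x y z" for x y z
  proof (rule assoc_mult_mat[symmetric])
    have 1: "fus C1 (?k x) (?k y) (?k z) = fus C x y z" by (simp add: u(2)[symmetric] k)
    have 2: "fus C2 (?h (?k x)) (?h (?k y)) (?h (?k z)) = fus C x y z"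
      by (simp add: t(2)[symmetric] h 1)
    show "W x y z \<in> carrier_mat (fus C x y z) (fus C x y z)" by (rule GL_matD[OF u(3)])
    show "V (?k x) (?k y) (?k z) \<in> carrier_mat (fus C x y z) (fus C x y z)"
      using GL_matD(1)[OF t(3)] unfolding 1[symmetric] .
    show "U (?h (?k x)) (?h (?k y)) (?h (?k z)) \<in> carrier_mat (fus C x y z) (fus C x y z)"
      using GL_matD(1)[OF s(3)] unfolding 2[symmetric] .
  qed
  then show ?thesis by (simp add: e kh comp_assoc)
qed

lemma compose_identity_symmetry:
  assumes "transports C s C'"
  shows "compose_symmetry (identity_symmetry C) s = s" "compose_symmetry s (identity_symmetry C') = s"
proof -
  obtain g U where Pair: "s = (g, U)" by (cases s)
  note T = transportsD[OF assms[unfolded Pair]]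
  have g: "g (inv_into UNIV g x) = x" for x using T(1) by (simp add: bij_is_surj surj_f_inv_f)
  have "fus C' (inv_into UNIV g x) (inv_into UNIV g y) (inv_into UNIV g z) = fus C x y z" for x y z
    by (simp add: T(2)[symmetric] g)
  then show "compose_symmetry (identity_symmetry C) s = s" "compose_symmetry s (identity_symmetry C') = s"
    by (simp_all add: Pair identity_symmetry_def
        left_mult_one_mat[OF GL_matD(1)[OF T(3)]] right_mult_one_mat[OF GL_matD(1)[OF T(3)]])
qed

lemma compose_inverse_symmetry:
  assumes "transports C s C'"
  shows "compose_symmetry s (inverse_symmetry s) = identity_symmetry C"
    "compose_symmetry (inverse_symmetry s) s = identity_symmetry C'"
proof -
  obtain g U where Pair: "s = (g, U)" by (cases s)
  note T = transportsD[OF assms[unfolded Pair]]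
  have g: "g (inv_into UNIV g x) = x" for x using T(1) by (simp add: bij_is_surj surj_f_inv_f)
  have 1: "g \<circ> inv_into UNIV g = id" "inv_into UNIV g \<circ> g = id"
    using T(1) by (auto simp: bij_is_surj surj_iff[symmetric] bij_is_inj)
  show "compose_symmetry s (inverse_symmetry s) = identity_symmetry C"
    using GL_matD(4)[OF T(3)] by (simp add: Pair inverse_symmetry_def identity_symmetry_def g 1)
  show "compose_symmetry (inverse_symmetry s) s = identity_symmetry C'"
    using GL_matD(3)[OF T(4)]
    by (simp add: Pair inverse_symmetry_def identity_symmetry_def g 1 inv_inv_eq[OF T(1)])
qed


section \<open>Symmetry groups\<close>

text \<open>The first isomorphism theorem for \<phi> followed by the projection modulo N: the set
  divided out is the kernel, and \<open>cover\<close> is surjectivity of the composite, so \<phi>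
  itself may fail to be surjective.\<close>

lemma FactGroup_iso_preimage:
  assumes "group_hom G G' \<phi>" and "N \<lhd> G'"
    and cover: "\<And>y. y \<in> carrier G' \<Longrightarrow> \<exists>x\<in>carrier G. \<exists>n\<in>N. y = n \<otimes>\<^bsub>G'\<^esub> \<phi> x"
  shows "G Mod {x \<in> carrier G. \<phi> x \<in> N} \<cong> G' Mod N" "group (G Mod {x \<in> carrier G. \<phi> x \<in> N})"
proof -
  interpret group_hom G G' \<phi> by fact
  interpret N: normal N G' by fact
  let ?\<psi> = "\<lambda>x. N #>\<^bsub>G'\<^esub> \<phi> x"
  have "?\<psi> \<in> hom G (G' Mod N)"
    using Group.hom_compose[OF homh N.r_coset_hom_Mod] by (simp add: comp_def)
  then interpret \<psi>: group_hom G "G' Mod N" ?\<psi>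
    using N.factorgroup_is_group by (simp add: group_hom_def group_hom_axioms_def)
  have "N #>\<^bsub>G'\<^esub> y = N \<longleftrightarrow> y \<in> N" if "y \<in> carrier G'" for y
    using that N.subgroup_axioms N.rcos_const[OF H.is_group]
    by (metis H.coset_join1 N.subset)
  then have kernel: "kernel G (G' Mod N) ?\<psi> = {x \<in> carrier G. \<phi> x \<in> N}"
    unfolding kernel_def using hom_closed by (simp cong: conj_cong)
  show "group (G Mod {x \<in> carrier G. \<phi> x \<in> N})"
    using normal.factorgroup_is_group[OF \<psi>.normal_kernel] unfolding kernel .
  have "?\<psi> ` carrier G = carrier (G' Mod N)"
  proof (intro equalityI subsetI)
    fix z assume "z \<in> carrier (G' Mod N)"
    then obtain y where y: "y \<in> carrier G'" "z = N #>\<^bsub>G'\<^esub> y" by (auto simp: carrier_FactGroup)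
    obtain x n where x: "x \<in> carrier G" "n \<in> N" "y = n \<otimes>\<^bsub>G'\<^esub> \<phi> x" using cover[OF y(1)] by blast
    have "n \<in> carrier G'" using x(2) N.subset by blast
    then have "N #>\<^bsub>G'\<^esub> y = (N #>\<^bsub>G'\<^esub> n) #>\<^bsub>G'\<^esub> \<phi> x"
      using x hom_closed N.subset by (simp add: H.coset_mult_assoc)
    then show "z \<in> ?\<psi> ` carrier G" using y x N.rcos_const[OF H.is_group x(2)] by auto
  qed auto
  then show "G Mod {x \<in> carrier G. \<phi> x \<in> N} \<cong> G' Mod N"
    by (rule \<psi>.FactGroup_iso[unfolded kernel])
qed

lemma symmetry_monoid_simps [simp]:
  "carrier (symmetry_monoid C S) = S"
  "x \<otimes>\<^bsub>symmetry_monoid C S\<^esub> y = compose_symmetry x y"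
  "\<one>\<^bsub>symmetry_monoid C S\<^esub> = identity_symmetry C"
  by (simp_all add: symmetry_monoid_def identity_symmetry_def)

abbreviation linear_automorphisms :: "('a::finite) mtc_data \<Rightarrow> 'a symmetry monoid" where
  "linear_automorphisms C \<equiv> symmetry_monoid C (linear_symmetries C)"

abbreviation natural_automorphisms :: "'a mtc_data \<Rightarrow> 'a symmetry set" where
  "natural_automorphisms C \<equiv> natural_isomorphism C ` {\<gamma>. \<forall>a. \<gamma> a \<noteq> 0}"

context
  fixes C :: "('a::finite) mtc_data"
  assumes C: "R_shaped C"
begin

lemma linear_symmetries_group: "group (linear_automorphisms C)"
proof (rule groupI)
  show "\<one>\<^bsub>linear_automorphisms C\<^esub> \<in> carrier (linear_automorphisms C)" using transports_identity[OF C] by (simp add: linear_symmetries_iff)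
next
  fix x y assume "x \<in> carrier (linear_automorphisms C)" "y \<in> carrier (linear_automorphisms C)"
  then show "x \<otimes>\<^bsub>linear_automorphisms C\<^esub> y \<in> carrier (linear_automorphisms C)"
    using transports_compose[OF _ _ C] by (simp add: linear_symmetries_iff)
next
  fix x y z assume "x \<in> carrier (linear_automorphisms C)" "y \<in> carrier (linear_automorphisms C)" "z \<in> carrier (linear_automorphisms C)"
  then show "x \<otimes>\<^bsub>linear_automorphisms C\<^esub> y \<otimes>\<^bsub>linear_automorphisms C\<^esub> z = x \<otimes>\<^bsub>linear_automorphisms C\<^esub> (y \<otimes>\<^bsub>linear_automorphisms C\<^esub> z)"
    using compose_symmetry_assoc[of C x C y C z C] by (simp add: linear_symmetries_iff)
next
  fix x assume "x \<in> carrier (linear_automorphisms C)"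
  then show "\<one>\<^bsub>linear_automorphisms C\<^esub> \<otimes>\<^bsub>linear_automorphisms C\<^esub> x = x"
    using compose_identity_symmetry(1) by (simp add: linear_symmetries_iff)
next
  fix x assume "x \<in> carrier (linear_automorphisms C)"
  then show "\<exists>y\<in>carrier (linear_automorphisms C). y \<otimes>\<^bsub>linear_automorphisms C\<^esub> x = \<one>\<^bsub>linear_automorphisms C\<^esub>"
    using transports_inverse[OF _ C, of x C] compose_inverse_symmetry(2)[of C x C]
    by (intro bexI[of _ "inverse_symmetry x"]) (simp_all add: linear_symmetries_iff)
qed

lemma linear_symmetries_inv:
  assumes "s \<in> linear_symmetries C"
  shows "inv\<^bsub>linear_automorphisms C\<^esub> s = inverse_symmetry s"
  using assms transports_inverse[OF _ C, of s C] compose_inverse_symmetry(2)[of C s C]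
  by (intro group.inv_equality[OF linear_symmetries_group]) (simp_all add: linear_symmetries_iff)

section \<open>Natural isomorphisms\<close>

lemma natural_isomorphism_transports:
  assumes "\<And>a. \<gamma> a \<noteq> 0"
  shows "transports C (natural_isomorphism C \<gamma>) C"
proof -
  let ?U = "\<lambda>a b c. (\<gamma> a * \<gamma> b / \<gamma> c) \<cdot>\<^sub>m 1\<^sub>m (fus C a b c)"
  have U: "?U a b c \<in> GL_mat (fus C a b c)"
    and inv: "matrix_inverse (?U a b c) = inverse (\<gamma> a * \<gamma> b / \<gamma> c) \<cdot>\<^sub>m 1\<^sub>m (fus C a b c)" for a b c
    by (rule GL_mat_smult; use assms in simp)+
  have R: "?U b a c * Rsym C a b c * matrix_inverse (?U a b c) = Rsym C a b c" for a b c
  proof -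
    have R: "Rsym C a b c \<in> carrier_mat (fus C b a c) (fus C a b c)"
      using C by (simp add: R_shaped_def)
    have "(x \<cdot>\<^sub>m 1\<^sub>m (fus C b a c)) * Rsym C a b c * (y \<cdot>\<^sub>m 1\<^sub>m (fus C a b c)) = (y * x) \<cdot>\<^sub>m Rsym C a b c"
      for x y
      using R mult_smult_assoc_mat[OF one_carrier_mat R, of x]
        mult_smult_distrib[OF smult_carrier_mat[OF R] one_carrier_mat, of x y]
      by (auto intro!: eq_matI)
    then show ?thesis
      unfolding inv using assms by (auto simp: mult.commute intro!: eq_matI)
  qed
  have F: "(\<Sum>\<alpha>'<fus C a b e. \<Sum>\<beta>'<fus C e c d. \<Sum>\<mu>'<fus C b c f. \<Sum>\<nu>'<fus C a f d.
       ?U a b e $$ (\<alpha>, \<alpha>') * ?U e c d $$ (\<beta>, \<beta>') * Fsym C a b c d (e, \<alpha>', \<beta>') (f, \<mu>', \<nu>') *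
       matrix_inverse (?U b c f) $$ (\<mu>', \<mu>) * matrix_inverse (?U a f d) $$ (\<nu>', \<nu>)) =
       Fsym C a b c d (e, \<alpha>, \<beta>) (f, \<mu>, \<nu>)" (is "?L = ?R")
    if ind: "\<alpha> < fus C a b e" "\<beta> < fus C e c d" "\<mu> < fus C b c f" "\<nu> < fus C a f d"
    for a b c d e f \<alpha> \<beta> \<mu> \<nu>
  proof -
    \<comment> \<open>The total scalar on an entry of F. Both fusion trees acquire \<gamma>(a)
      \<gamma>(b) \<gamma>(c) / \<gamma>(d), since the contributions of the internal edges e and f
      cancel.\<close>
    let ?k = "(\<gamma> a * \<gamma> b / \<gamma> e) * (\<gamma> e * \<gamma> c / \<gamma> d) *
      inverse (\<gamma> b * \<gamma> c / \<gamma> f) * inverse (\<gamma> a * \<gamma> f / \<gamma> d)"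
    have k: "?k = 1" using assms by (simp add: field_simps)
    have "?L = (\<Sum>\<alpha>'<fus C a b e. \<Sum>\<beta>'<fus C e c d. \<Sum>\<mu>'<fus C b c f. \<Sum>\<nu>'<fus C a f d. ?k *
       (1\<^sub>m (fus C a b e) $$ (\<alpha>, \<alpha>') * 1\<^sub>m (fus C e c d) $$ (\<beta>, \<beta>') *
       Fsym C a b c d (e, \<alpha>', \<beta>') (f, \<mu>', \<nu>') *
       1\<^sub>m (fus C b c f) $$ (\<mu>', \<mu>) * 1\<^sub>m (fus C a f d) $$ (\<nu>', \<nu>)))"
      unfolding inv by (intro sum.cong refl) (use ind in simp)
    also have "\<dots> = ?R"
      unfolding k mult_1_left
      by (rule change_of_bases_one[OF ind, of "\<lambda>\<alpha>' \<beta>' \<mu>' \<nu>'. Fsym C a b c d (e, \<alpha>', \<beta>') (f, \<mu>', \<nu>')"])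
    finally show ?thesis .
  qed
  show ?thesis
    unfolding transports_def natural_isomorphism_def case_prod_conv id_apply
    by (intro conjI allI impI bij_id bij_id[unfolded id_def] refl U R F)
qed

lemma compose_natural_isomorphisms:
  "compose_symmetry (natural_isomorphism C \<gamma>) (natural_isomorphism C \<delta>) =
   natural_isomorphism C (\<lambda>a. \<gamma> a * \<delta> a)"
proof -
  have "(x \<cdot>\<^sub>m 1\<^sub>m n) * (y \<cdot>\<^sub>m 1\<^sub>m n) = (x * y) \<cdot>\<^sub>m 1\<^sub>m n" for x y :: complex and n
    by (subst smult_one_mult(1)[of _ n]) (auto intro!: eq_matI)
  then show ?thesis by (simp add: natural_isomorphism_def mult_ac)
qed

lemma natural_isomorphism_one: "natural_isomorphism C (\<lambda>_. 1) = identity_symmetry C"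
  by (auto simp: natural_isomorphism_def identity_symmetry_def intro!: ext eq_matI)

lemma identity_natural: "identity_symmetry C \<in> natural_automorphisms C"
  by (rule image_eqI[of _ _ "\<lambda>_. 1"]) (simp_all add: natural_isomorphism_one)

text \<open>Scalar matrices commute with \<open>U\<close>, so only the anyon labels of \<gamma> are
  moved. With \<open>C' = C\<close> this gives normality; in general it lets natural isomorphisms
  pass through a change of presentation.\<close>

lemma natural_isomorphism_slide:
  assumes "transports C (g, U) C'"
  shows "compose_symmetry (g, U) (natural_isomorphism C' \<gamma>) =
    compose_symmetry (natural_isomorphism C (\<gamma> \<circ> inv_into UNIV g)) (g, U)"
proof -
  note T = transportsD[OF assms]
  have g: "g (inv_into UNIV g x) = x" for x using T(1) by (simp add: bij_is_surj surj_f_inv_f)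
  have "fus C' (inv_into UNIV g x) (inv_into UNIV g y) (inv_into UNIV g z) = fus C x y z" for x y z
    by (simp add: T(2)[symmetric] g)
  then show ?thesis
    by (simp add: natural_isomorphism_def smult_one_mult[OF GL_matD(1)[OF T(3)]])
qed

lemma natural_isomorphisms_linear: "natural_automorphisms C \<subseteq> linear_symmetries C"
  using natural_isomorphism_transports by (auto simp: linear_symmetries_iff)

lemma natural_isomorphisms_normal: "natural_automorphisms C \<lhd> (linear_automorphisms C)"
proof -
  interpret group "linear_automorphisms C" by (rule linear_symmetries_group)
  have inverse: "inv\<^bsub>linear_automorphisms C\<^esub> (natural_isomorphism C \<gamma>) = natural_isomorphism C (\<lambda>a. inverse (\<gamma> a))"
    if "\<forall>a. \<gamma> a \<noteq> 0" for \<gamma>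
    using natural_isomorphism_transports[of \<gamma>] natural_isomorphism_transports[of "\<lambda>a. inverse (\<gamma> a)"] that
    by (intro inv_equality)
       (simp_all add: linear_symmetries_iff compose_natural_isomorphisms flip: natural_isomorphism_one)
  have "subgroup (natural_automorphisms C) (linear_automorphisms C)"
  proof (rule subgroupI)
    fix x assume "x \<in> natural_automorphisms C"
    then obtain \<gamma> where g: "\<forall>a. \<gamma> a \<noteq> 0" "x = natural_isomorphism C \<gamma>" by auto
    show "inv\<^bsub>linear_automorphisms C\<^esub> x \<in> natural_automorphisms C" unfolding g(2) inverse[OF g(1)] using g(1) by (intro imageI) auto
  next
    fix x y assume "x \<in> natural_automorphisms C" "y \<in> natural_automorphisms C"
    then show "x \<otimes>\<^bsub>linear_automorphisms C\<^esub> y \<in> natural_automorphisms C" by (auto simp: compose_natural_isomorphisms intro!: imageI)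
  next
    show "natural_automorphisms C \<noteq> {}" using identity_natural by (rule ex_in_conv[THEN iffD1, OF exI])
  qed (simp add: natural_isomorphisms_linear)
  moreover have "x \<otimes>\<^bsub>linear_automorphisms C\<^esub> n \<otimes>\<^bsub>linear_automorphisms C\<^esub> inv\<^bsub>linear_automorphisms C\<^esub> x \<in> natural_automorphisms C" if x: "x \<in> carrier (linear_automorphisms C)" and n: "n \<in> natural_automorphisms C" for x n
  proof -
    obtain g U where gU: "x = (g, U)" by (cases x)
    obtain \<gamma> where \<gamma>: "\<forall>a. \<gamma> a \<noteq> 0" "n = natural_isomorphism C \<gamma>" using n by auto
    let ?n = "natural_isomorphism C (\<gamma> \<circ> inv_into UNIV g)"
    have "?n \<in> natural_automorphisms C" using \<gamma>(1) by (intro imageI) auto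
    moreover have "x \<otimes>\<^bsub>linear_automorphisms C\<^esub> n = ?n \<otimes>\<^bsub>linear_automorphisms C\<^esub> x"
      using natural_isomorphism_slide[of g U C \<gamma>] x by (simp add: gU \<gamma> linear_symmetries_iff)
    moreover have "?n \<in> carrier (linear_automorphisms C)" using \<open>?n \<in> natural_automorphisms C\<close> natural_isomorphisms_linear by auto
    ultimately show ?thesis using x by (simp add: m_assoc del: symmetry_monoid_simps)
  qed
  ultimately show ?thesis by (simp add: normal_inv_iff del: symmetry_monoid_simps)
qed

section \<open>Unitary symmetries\<close>

lemma unitary_symmetries_subgroup: "subgroup (unitary_symmetries C) (linear_automorphisms C)"
proof -
  interpret group "linear_automorphisms C" by (rule linear_symmetries_group)
  have unitary_iff: "(g, U) \<in> unitary_symmetries C \<longleftrightarrow>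
      transports C (g, U) C \<and> (\<forall>a b c. unitary_mat (U a b c))" for g U
    by (simp add: unitary_symmetries_def linear_symmetries_iff)
  show ?thesis
  proof (rule subgroupI)
    show "unitary_symmetries C \<subseteq> carrier (linear_automorphisms C)" by (auto simp: unitary_symmetries_def)
    have "identity_symmetry C \<in> unitary_symmetries C"
      using transports_identity[OF C] by (simp add: identity_symmetry_def unitary_iff unitary_mat_one)
    then show "unitary_symmetries C \<noteq> {}" by blast
  next
    fix s assume s: "s \<in> unitary_symmetries C"
    obtain g U where gU: "s = (g, U)" by (cases s)
    have T: "transports C (g, U) C" and U: "unitary_mat (U a b c)" for a b c
      using s by (simp_all add: gU unitary_iff)
    have "inverse_symmetry s \<in> unitary_symmetries C"
      using transports_inverse[OF T C] unitary_mat_inverse[OF transportsD(4)[OF T] U]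
      by (simp add: gU inverse_symmetry_def unitary_iff)
    then show "inv\<^bsub>linear_automorphisms C\<^esub> s \<in> unitary_symmetries C"
      using T by (simp add: linear_symmetries_inv linear_symmetries_iff gU)
  next
    fix s t assume st: "s \<in> unitary_symmetries C" "t \<in> unitary_symmetries C"
    obtain h V g U where e: "s = (h, V)" "t = (g, U)" by (cases s, cases t)
    have S: "transports C (h, V) C" "unitary_mat (V a b c)"
      and T: "transports C (g, U) C" "unitary_mat (U a b c)" for a b c
      using st by (simp_all add: e unitary_iff)
    have h: "h (inv_into UNIV h x) = x" for x
      using transportsD(1)[OF S(1)] by (simp add: bij_is_surj surj_f_inv_f)
    have f: "fus C (inv_into UNIV h x) (inv_into UNIV h y) (inv_into UNIV h z) = fus C x y z" for x y z
      using transportsD(2)[OF S(1), of "inv_into UNIV h x" "inv_into UNIV h y" "inv_into UNIV h z"]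
      by (simp add: h)
    have "unitary_mat (U (inv_into UNIV h x) (inv_into UNIV h y) (inv_into UNIV h z) * V x y z)" for x y z
      using transportsD(3)[OF T(1), of "inv_into UNIV h x" "inv_into UNIV h y" "inv_into UNIV h z"]
      by (intro unitary_mat_mult[OF _ transportsD(3)[OF S(1)] T(2) S(2)]) (simp add: f)
    then show "s \<otimes>\<^bsub>linear_automorphisms C\<^esub> t \<in> unitary_symmetries C"
      using transports_compose[OF S(1) T(1) C] by (simp add: e unitary_iff)
  qed
qed

text \<open>
  Where \<open>fus C a b c\<close> vanishes there is no condition on \<open>\<gamma>\<close>; elsewhere unitarity says that the
  moduli satisfy \<open>\<bar>\<gamma> a\<bar> * \<bar>\<gamma> b\<bar> = \<bar>\<gamma> c\<bar>\<close>, so dividing \<open>\<gamma>\<close> by its modulus changes nothing.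
\<close>

lemma unitary_natural_isomorphisms:
  "natural_isomorphism C ` {\<gamma>. \<forall>a. cmod (\<gamma> a) = 1} = {s \<in> unitary_symmetries C. s \<in> natural_automorphisms C}"
proof (intro equalityI subsetI)
  fix s assume "s \<in> natural_isomorphism C ` {\<gamma>. \<forall>a. cmod (\<gamma> a) = 1}"
  then obtain \<gamma> where \<gamma>: "\<forall>a. cmod (\<gamma> a) = 1" "s = natural_isomorphism C \<gamma>" by auto
  have "\<gamma> a \<noteq> 0" for a using \<gamma>(1) by (metis norm_zero zero_neq_one)
  then show "s \<in> {s \<in> unitary_symmetries C. s \<in> natural_automorphisms C}"
    using natural_isomorphism_transports[of \<gamma>] \<gamma>(1)
    by (auto simp: \<gamma>(2) unitary_symmetries_def linear_symmetries_iff natural_isomorphism_def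
        unitary_mat_smult_one norm_mult norm_divide)
next
  fix s assume "s \<in> {s \<in> unitary_symmetries C. s \<in> natural_automorphisms C}"
  then obtain \<gamma> where \<gamma>: "\<forall>a. \<gamma> a \<noteq> 0" "s = natural_isomorphism C \<gamma>" and s: "s \<in> unitary_symmetries C"
    by auto
  define \<delta> where "\<delta> = (\<lambda>a. \<gamma> a / of_real (cmod (\<gamma> a)))"
  have "(\<gamma> a * \<gamma> b / \<gamma> c) \<cdot>\<^sub>m 1\<^sub>m (fus C a b c) = (\<delta> a * \<delta> b / \<delta> c) \<cdot>\<^sub>m 1\<^sub>m (fus C a b c)" for a b c
  proof -
    have "fus C a b c = 0 \<or> cmod (\<gamma> a * \<gamma> b / \<gamma> c) = 1"
      using s by (simp add: \<gamma>(2) natural_isomorphism_def unitary_symmetries_def unitary_mat_smult_one)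
    then consider "fus C a b c = 0" | "cmod (\<gamma> c) = cmod (\<gamma> a) * cmod (\<gamma> b)"
      using \<gamma>(1) by (auto simp: norm_mult norm_divide)
    then show ?thesis
    proof cases
      case 1
      then show ?thesis by (intro eq_matI) auto
    next
      case 2
      then have "\<delta> a * \<delta> b / \<delta> c = \<gamma> a * \<gamma> b / \<gamma> c"
        using \<gamma>(1) by (simp add: \<delta>_def field_simps)
      then show ?thesis by simp
    qed
  qed
  then have "s = natural_isomorphism C \<delta>" by (simp add: \<gamma>(2) natural_isomorphism_def)
  moreover have "\<forall>a. cmod (\<delta> a) = 1" using \<gamma>(1) by (simp add: \<delta>_def norm_divide)
  ultimately show "s \<in> natural_isomorphism C ` {\<gamma>. \<forall>a. cmod (\<gamma> a) = 1}" by blast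
qed

text \<open>\<open>unitary_gauge\<close> is the covering condition for the inclusion: if n composed
  with y is unitary, then y is the inverse of n composed with a unitary symmetry.\<close>

lemma unitary_symmetry_group_iso:
  assumes "unitary_gauge C"
  shows "unitary_symmetry_group C \<cong> linear_symmetry_group C" "group (unitary_symmetry_group C)"
proof -
  interpret group "linear_automorphisms C" by (rule linear_symmetries_group)
  let ?M = "symmetry_monoid C (unitary_symmetries C)"
  have M: "?M = (linear_automorphisms C)\<lparr>carrier := unitary_symmetries C\<rparr>" by (simp add: symmetry_monoid_def)
  have "group ?M" unfolding M by (rule subgroup_imp_group[OF unitary_symmetries_subgroup])
  moreover have "id \<in> hom ?M (linear_automorphisms C)" by (auto simp: hom_def unitary_symmetries_def)
  ultimately have hom: "group_hom ?M (linear_automorphisms C) id"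
    using linear_symmetries_group by (simp add: group_hom_def group_hom_axioms_def)
  have cover: "\<exists>x\<in>carrier ?M. \<exists>n\<in>natural_automorphisms C. y = n \<otimes>\<^bsub>linear_automorphisms C\<^esub> id x" if y: "y \<in> carrier (linear_automorphisms C)" for y
  proof -
    obtain \<gamma> where \<gamma>: "\<forall>a. \<gamma> a \<noteq> 0"
      "natural_isomorphism C \<gamma> \<otimes>\<^bsub>linear_automorphisms C\<^esub> y \<in> unitary_symmetries C" (is "?n \<otimes>\<^bsub>linear_automorphisms C\<^esub> y \<in> _")
      using assms y by (auto simp: unitary_gauge_def)
    have n: "?n \<in> natural_automorphisms C" using \<gamma>(1) by blast
    have "y = inv\<^bsub>linear_automorphisms C\<^esub> ?n \<otimes>\<^bsub>linear_automorphisms C\<^esub> (?n \<otimes>\<^bsub>linear_automorphisms C\<^esub> y)"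
    proof -
      have "?n \<in> carrier (linear_automorphisms C)" using n natural_isomorphisms_linear by auto
      then show ?thesis using y by (metis m_assoc inv_closed l_inv l_one)
    qed
    moreover have "inv\<^bsub>linear_automorphisms C\<^esub> ?n \<in> natural_automorphisms C"
      using subgroup.m_inv_closed[OF normal_imp_subgroup[OF natural_isomorphisms_normal] n] .
    moreover have "id (?n \<otimes>\<^bsub>linear_automorphisms C\<^esub> y) \<in> carrier ?M" using \<gamma>(2) by simp
    ultimately show ?thesis by (intro bexI) (simp_all only: id_apply)
  qed
  note FactGroup_iso_preimage[OF hom natural_isomorphisms_normal cover]
  then show "unitary_symmetry_group C \<cong> linear_symmetry_group C" "group (unitary_symmetry_group C)"
    unfolding unitary_symmetry_group_def linear_symmetry_group_def unitary_natural_isomorphisms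
    by simp_all
qed

end

text \<open>Sliding s to the left past t leaves t next to its inverse, and only the relabelled
  natural isomorphism remains.\<close>

lemma transports_natural_isomorphism:
  assumes "transports C t C'" "R_shaped C" "s \<in> natural_automorphisms C'"
  shows "compose_symmetry t (compose_symmetry s (inverse_symmetry t)) \<in>
    natural_automorphisms C"
proof -
  obtain g U where gU: "t = (g, U)" by (cases t)
  obtain \<gamma> where \<gamma>: "\<forall>a. \<gamma> a \<noteq> 0" "s = natural_isomorphism C' \<gamma>" using assms(3) by auto
  have C': "R_shaped C'" using R_shaped_transports[OF assms(1,2)] .
  have s: "transports C' s C'" using natural_isomorphism_transports[OF C'] \<gamma> by blast
  have ti: "transports C' (inverse_symmetry t) C" using transports_inverse[OF assms(1,2)] .
  let ?n = "natural_isomorphism C (\<gamma> \<circ> inv_into UNIV g)"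
  have n: "transports C ?n C" by (rule natural_isomorphism_transports[OF assms(2)]) (use \<gamma>(1) in simp)
  have "compose_symmetry t (compose_symmetry s (inverse_symmetry t))
      = compose_symmetry (compose_symmetry t s) (inverse_symmetry t)"
    using compose_symmetry_assoc[OF assms(1) s ti] by simp
  also have "compose_symmetry t s = compose_symmetry ?n t"
    using natural_isomorphism_slide[OF assms(2)] assms(1) by (simp add: gU \<gamma>(2) del: compose_symmetry.simps)
  also have "compose_symmetry (compose_symmetry ?n t) (inverse_symmetry t)
      = compose_symmetry ?n (compose_symmetry t (inverse_symmetry t))"
    by (rule compose_symmetry_assoc[OF n assms(1) ti])
  also have "\<dots> = ?n"
    using compose_inverse_symmetry(1)[OF assms(1)] compose_identity_symmetry(2)[OF n] by simp
  finally show ?thesis using \<gamma>(1) by auto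
qed

text \<open>In the groupoid, the automorphism groups of two objects joined by an arrow are
  conjugate. That arrow and its inverse both respect natural isomorphisms, so the quotients
  correspond too.\<close>

lemma linear_symmetry_group_transports:
  assumes t: "transports C t C'" and C: "R_shaped C"
  shows "linear_symmetry_group C' \<cong> linear_symmetry_group C"
proof -
  have C': "R_shaped C'" using R_shaped_transports[OF t C] .
  define u where "u = inverse_symmetry t"
  have u: "transports C' u C" unfolding u_def using transports_inverse[OF t C] .
  have tu: "compose_symmetry t u = identity_symmetry C" and ut: "compose_symmetry u t = identity_symmetry C'"
    unfolding u_def using compose_inverse_symmetry[OF t] by auto
  define \<phi> where "\<phi> = (\<lambda>s. compose_symmetry t (compose_symmetry s u))"
  define \<psi> where "\<psi> = (\<lambda>s. compose_symmetry u (compose_symmetry s t))"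
  note comp = transports_compose[OF _ _ C] transports_compose[OF _ _ C']
  have \<phi>: "transports C (\<phi> s) C" if "transports C' s C'" for s
    unfolding \<phi>_def using comp that t u by blast
  have \<psi>: "transports C' (\<psi> s) C'" if "transports C s C" for s
    unfolding \<psi>_def using comp that t u by blast
  have cancel_ut: "compose_symmetry u (compose_symmetry t s) = s" if "transports C' s D" for s D
    using compose_symmetry_assoc[OF u t that] ut compose_identity_symmetry(1)[OF that] by simp
  have cancel_tu: "compose_symmetry t (compose_symmetry u s) = s" if "transports C s D" for s D
    using compose_symmetry_assoc[OF t u that] tu compose_identity_symmetry(1)[OF that] by simp
  have \<psi>\<phi>: "\<psi> (\<phi> s) = s" if s: "transports C' s C'" for s
  proof -
    have su: "transports C' (compose_symmetry s u) C" using comp s u by blast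
    have "\<psi> (\<phi> s) = compose_symmetry u (compose_symmetry t (compose_symmetry (compose_symmetry s u) t))"
      unfolding \<psi>_def \<phi>_def using compose_symmetry_assoc[OF t su t] by simp
    also have "\<dots> = compose_symmetry s (compose_symmetry u t)"
      using cancel_ut comp(2)[OF su t] compose_symmetry_assoc[OF s u t] by simp
    finally show ?thesis using ut compose_identity_symmetry(2)[OF s] by simp
  qed
  have \<phi>\<psi>: "\<phi> (\<psi> s) = s" if s: "transports C s C" for s
  proof -
    have st: "transports C (compose_symmetry s t) C'" using comp s t by blast
    have "\<phi> (\<psi> s) = compose_symmetry t (compose_symmetry u (compose_symmetry (compose_symmetry s t) u))"
      unfolding \<psi>_def \<phi>_def using compose_symmetry_assoc[OF u st u] by simp
    also have "\<dots> = compose_symmetry s (compose_symmetry t u)"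
      using cancel_tu comp(1)[OF st u] compose_symmetry_assoc[OF s t u] by simp
    finally show ?thesis using tu compose_identity_symmetry(2)[OF s] by simp
  qed
  have "\<phi> (compose_symmetry r s) = compose_symmetry (\<phi> r) (\<phi> s)"
    if r: "transports C' r C'" and s: "transports C' s C'" for r s
  proof -
    have su: "transports C' (compose_symmetry s u) C" using comp s u by blast
    have ru: "transports C' (compose_symmetry r u) C" using comp r u by blast
    have "\<phi> r = compose_symmetry t (compose_symmetry r u)" by (simp only: \<phi>_def)
    then have "compose_symmetry (\<phi> r) (\<phi> s) = compose_symmetry t (compose_symmetry (compose_symmetry r u) (\<phi> s))"
      using compose_symmetry_assoc[OF t ru \<phi>[OF s]] by simp
    also have "compose_symmetry (compose_symmetry r u) (\<phi> s) = compose_symmetry r (compose_symmetry u (\<phi> s))"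
      by (rule compose_symmetry_assoc[OF r u \<phi>[OF s]])
    also have "compose_symmetry u (\<phi> s) = compose_symmetry s u"
      unfolding \<phi>_def by (rule cancel_ut[OF su])
    also have "compose_symmetry r (compose_symmetry s u) = compose_symmetry (compose_symmetry r s) u"
      using compose_symmetry_assoc[OF r s u] by simp
    finally show ?thesis by (simp add: \<phi>_def)
  qed
  then have "group_hom (linear_automorphisms C') (linear_automorphisms C) \<phi>"
    using linear_symmetries_group[OF C] linear_symmetries_group[OF C'] \<phi>
    by (auto simp: group_hom_def group_hom_axioms_def hom_def linear_symmetries_iff)
  \<comment> \<open>Here \<phi> is surjective outright, with \<psi> as a right inverse, so the
    identity serves as the natural factor.\<close>
  moreover have "\<exists>x\<in>carrier (linear_automorphisms C'). \<exists>n\<in>natural_automorphisms C. y = n \<otimes>\<^bsub>linear_automorphisms C\<^esub> \<phi> x" if "y \<in> carrier (linear_automorphisms C)" for y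
  proof -
    have y: "transports C y C" using that by (simp add: linear_symmetries_iff)
    have "y = identity_symmetry C \<otimes>\<^bsub>linear_automorphisms C\<^esub> \<phi> (\<psi> y)"
      using \<phi>\<psi>[OF y] compose_identity_symmetry(1)[OF y] by simp
    moreover have "\<psi> y \<in> carrier (linear_automorphisms C')"
      using \<psi>[OF y] by (simp add: linear_symmetries_iff)
    ultimately show ?thesis using identity_natural[OF C] by (intro bexI)
  qed
  ultimately have "linear_automorphisms C' Mod {s \<in> carrier (linear_automorphisms C'). \<phi> s \<in> natural_automorphisms C} \<cong> linear_automorphisms C Mod natural_automorphisms C"
    by (rule FactGroup_iso_preimage(1)[OF _ natural_isomorphisms_normal[OF C]])
  moreover have "{s \<in> carrier (linear_automorphisms C'). \<phi> s \<in> natural_automorphisms C} = natural_automorphisms C'"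
  proof (intro equalityI subsetI)
    fix s assume s: "s \<in> {s \<in> carrier (linear_automorphisms C'). \<phi> s \<in> natural_automorphisms C}"
    \<comment> \<open>Needed to read \<psi> as conjugation by \<open>u\<close>, so that it too
      preserves natural isomorphisms.\<close>
    have "inverse_symmetry u = t"
    proof -
      have "inverse_symmetry u = compose_symmetry (compose_symmetry t u) (inverse_symmetry u)"
        using tu compose_identity_symmetry(1)[OF transports_inverse[OF u C']] by simp
      also have "\<dots> = compose_symmetry t (compose_symmetry u (inverse_symmetry u))"
        by (rule compose_symmetry_assoc[OF t u transports_inverse[OF u C']])
      also have "\<dots> = t"
        using compose_inverse_symmetry(1)[OF u] compose_identity_symmetry(2)[OF t] by simp
      finally show ?thesis .
    qed
    then have "\<psi> (\<phi> s) \<in> natural_automorphisms C'"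
      using transports_natural_isomorphism[OF u C', of "\<phi> s"] s unfolding \<psi>_def by simp
    then show "s \<in> natural_automorphisms C'" using \<psi>\<phi> s by (simp add: linear_symmetries_iff)
  next
    fix s assume "s \<in> natural_automorphisms C'"
    then show "s \<in> {s \<in> carrier (linear_automorphisms C'). \<phi> s \<in> natural_automorphisms C}"
      using natural_isomorphisms_linear[OF C'] transports_natural_isomorphism[OF t C]
      unfolding \<phi>_def u_def by auto
  qed
  ultimately show ?thesis by (simp add: linear_symmetry_group_def)
qed


section \<open>Galois conjugation\<close>

definition conjugate_symmetry :: "(complex \<Rightarrow> complex) \<Rightarrow> 'a symmetry \<Rightarrow> 'a symmetry" where
  "conjugate_symmetry \<sigma> s = (fst s, \<lambda>a b c. map_mat \<sigma> (snd s a b c))"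

context
  fixes \<sigma> :: "complex \<Rightarrow> complex"
  assumes \<sigma>: "field_hom \<sigma>"
begin

interpretation field_hom \<sigma> by (rule \<sigma>)

lemma GL_mat_map_mat:
  assumes "A \<in> GL_mat n"
  shows "map_mat \<sigma> A \<in> GL_mat n" "matrix_inverse (map_mat \<sigma> A) = map_mat \<sigma> (matrix_inverse A)"
proof -
  note A = GL_matD[OF assms]
  have *: "map_mat \<sigma> A * map_mat \<sigma> (matrix_inverse A) = 1\<^sub>m n"
    using mat_hom_mult[OF A(1,2)] A(3) by (simp add: mat_hom_one)
  show "map_mat \<sigma> A \<in> GL_mat n" "matrix_inverse (map_mat \<sigma> A) = map_mat \<sigma> (matrix_inverse A)"
    by (rule GL_matI[OF _ _ *]; use A in simp)+
qed

text \<open>The conditions are polynomial identities with integer coefficients in the entries of R,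
  F, \<open>U\<close> and the inverses of \<open>U\<close>, and entrywise application of a field
  homomorphism commutes with matrix inversion.\<close>

lemma transports_galois_conjugate:
  assumes "transports C s C'" "R_shaped C"
  shows "transports (galois_conjugate \<sigma> C) (conjugate_symmetry \<sigma> s) (galois_conjugate \<sigma> C')"
proof -
  obtain g U where gU: "s = (g, U)" by (cases s)
  note T = transportsD[OF assms(1)[unfolded gU]]
  have R: "map_mat \<sigma> (Rsym C' a b c) = map_mat \<sigma> (U (g b) (g a) (g c)) *
      map_mat \<sigma> (Rsym C (g a) (g b) (g c)) * map_mat \<sigma> (matrix_inverse (U (g a) (g b) (g c)))" for a b c
  proof -
    have "Rsym C (g a) (g b) (g c) \<in> carrier_mat (fus C' b a c) (fus C' a b c)"
      using assms(2) by (simp add: R_shaped_def T(2)[symmetric])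
    note Rc = this
    note UR = mult_carrier_mat[OF GL_matD(1)[OF T(4)] Rc]
    show ?thesis
      unfolding T(5) mat_hom_mult[OF UR GL_matD(2)[OF T(4)]] mat_hom_mult[OF GL_matD(1)[OF T(4)] Rc] ..
  qed
  have F: "\<sigma> (Fsym C' a b c d (e, \<alpha>, \<beta>) (f, \<mu>, \<nu>)) =
     (\<Sum>\<alpha>'<fus C' a b e. \<Sum>\<beta>'<fus C' e c d. \<Sum>\<mu>'<fus C' b c f. \<Sum>\<nu>'<fus C' a f d.
        map_mat \<sigma> (U (g a) (g b) (g e)) $$ (\<alpha>, \<alpha>') * map_mat \<sigma> (U (g e) (g c) (g d)) $$ (\<beta>, \<beta>') *
        \<sigma> (Fsym C (g a) (g b) (g c) (g d) (g e, \<alpha>', \<beta>') (g f, \<mu>', \<nu>')) *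
        map_mat \<sigma> (matrix_inverse (U (g b) (g c) (g f))) $$ (\<mu>', \<mu>) *
        map_mat \<sigma> (matrix_inverse (U (g a) (g f) (g d))) $$ (\<nu>', \<nu>))"
    if ind: "\<alpha> < fus C' a b e" "\<beta> < fus C' e c d" "\<mu> < fus C' b c f" "\<nu> < fus C' a f d"
    for a b c d e f \<alpha> \<beta> \<mu> \<nu>
    unfolding T(6)[OF ind] hom_sum
    by (intro sum.cong refl)
       (use ind in \<open>simp add: hom_mult carrier_matD[OF GL_matD(1)[OF T(4)]]
          carrier_matD[OF GL_matD(2)[OF T(4)]]\<close>)
  show ?thesis
    using T(1,2) GL_mat_map_mat[OF T(3)] R F
    by (simp add: transports_def gU conjugate_symmetry_def galois_conjugate_def)
qed

lemma conjugate_symmetry_compose: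
  assumes "transports C s C'" "transports C' t C''"
  shows "conjugate_symmetry \<sigma> (compose_symmetry s t) =
    compose_symmetry (conjugate_symmetry \<sigma> s) (conjugate_symmetry \<sigma> t)"
proof -
  obtain h V g U where e: "s = (h, V)" "t = (g, U)" by (cases s, cases t)
  note T = transportsD[OF assms(1)[unfolded e]] and T' = transportsD[OF assms(2)[unfolded e]]
  have h: "h (inv_into UNIV h x) = x" for x using T(1) by (simp add: bij_is_surj surj_f_inv_f)
  have f: "fus C' (inv_into UNIV h x) (inv_into UNIV h y) (inv_into UNIV h z) = fus C x y z" for x y z
    by (simp add: T(2)[symmetric] h)
  have "map_mat \<sigma> (U (inv_into UNIV h x) (inv_into UNIV h y) (inv_into UNIV h z) * V x y z) =
    map_mat \<sigma> (U (inv_into UNIV h x) (inv_into UNIV h y) (inv_into UNIV h z)) * map_mat \<sigma> (V x y z)"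
    for x y z
    using GL_matD(1)[OF T'(3)[of "inv_into UNIV h x" "inv_into UNIV h y" "inv_into UNIV h z"]]
    by (intro mat_hom_mult[OF _ GL_matD(1)[OF T(3)]]) (simp add: f)
  then show ?thesis by (simp add: e conjugate_symmetry_def)
qed

text \<open>The new scalars are \<sigma> applied to the old ones. Being nonzero is preserved,
  whereas having modulus 1 need not be.\<close>

lemma conjugate_natural_isomorphism:
  assumes "s \<in> natural_automorphisms C"
  shows "conjugate_symmetry \<sigma> s \<in> natural_automorphisms (galois_conjugate \<sigma> C)"
proof -
  obtain \<gamma> where \<gamma>: "\<forall>a. \<gamma> a \<noteq> 0" "s = natural_isomorphism C \<gamma>" using assms by auto
  have "map_mat \<sigma> (x \<cdot>\<^sub>m 1\<^sub>m n) = \<sigma> x \<cdot>\<^sub>m 1\<^sub>m n" for x n by (intro eq_matI) auto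
  then have "conjugate_symmetry \<sigma> s = natural_isomorphism (galois_conjugate \<sigma> C) (\<sigma> \<circ> \<gamma>)"
    by (simp add: \<gamma>(2) conjugate_symmetry_def natural_isomorphism_def galois_conjugate_def
        hom_mult hom_inverse divide_inverse)
  moreover have "\<forall>a. (\<sigma> \<circ> \<gamma>) a \<noteq> 0" using \<gamma>(1) by simp
  ultimately show ?thesis by blast
qed

end

lemma R_shaped_galois_conjugate: "R_shaped C \<Longrightarrow> R_shaped (galois_conjugate q C)"
  by (simp add: R_shaped_def galois_conjugate_def)

lemma galois_conjugate_inverse:
  assumes "\<And>x. \<tau> (\<sigma> x) = x"
  shows "galois_conjugate \<tau> (galois_conjugate \<sigma> C) = C"
    "conjugate_symmetry \<tau> (conjugate_symmetry \<sigma> s) = s"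
proof -
  have "map_mat \<tau> (map_mat \<sigma> A) = A" for A by (intro eq_matI) (auto simp: assms)
  then show "galois_conjugate \<tau> (galois_conjugate \<sigma> C) = C"
    "conjugate_symmetry \<tau> (conjugate_symmetry \<sigma> s) = s"
    by (simp_all add: galois_conjugate_def conjugate_symmetry_def assms)
qed

text \<open>The inverse \<tau> of \<sigma> is again a field homomorphism. It provides preimages of
  all symmetries of the conjugate and brings natural isomorphisms back to natural ones.\<close>

lemma linear_symmetry_group_automorphism:
  assumes C: "R_shaped C" and \<sigma>: "field_hom \<sigma>" "bij \<sigma>"
  shows "linear_symmetry_group C \<cong> linear_symmetry_group (galois_conjugate \<sigma> C)"
proof -
  define \<tau> where "\<tau> = inv_into UNIV \<sigma>"
  interpret field_hom \<sigma> by fact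
  have \<sigma>\<tau>: "\<sigma> (\<tau> x) = x" for x using \<sigma>(2) by (simp add: \<tau>_def bij_is_surj surj_f_inv_f)
  have \<tau>\<sigma>: "\<tau> (\<sigma> x) = x" for x using \<sigma>(2) by (simp add: \<tau>_def bij_is_inj)
  have \<tau>: "field_hom \<tau>"
    by unfold_locales (metis \<sigma>\<tau> \<tau>\<sigma> hom_add hom_mult hom_zero hom_one)+
  define D where "D = galois_conjugate \<sigma> C"
  have D: "R_shaped D" and \<tau>D: "galois_conjugate \<tau> D = C"
    unfolding D_def using R_shaped_galois_conjugate[OF C] galois_conjugate_inverse(1)[of \<tau> \<sigma>, OF \<tau>\<sigma>] by auto
  have to_D: "conjugate_symmetry \<sigma> s \<in> linear_symmetries D" if "s \<in> linear_symmetries C" for s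
    using transports_galois_conjugate[OF \<sigma>(1) _ C] that unfolding D_def linear_symmetries_iff by blast
  have from_D: "conjugate_symmetry \<tau> s \<in> linear_symmetries C" if "s \<in> linear_symmetries D" for s
    using transports_galois_conjugate[OF \<tau> _ D, of s D] that unfolding \<tau>D linear_symmetries_iff by blast
  have "group_hom (linear_automorphisms C) (linear_automorphisms D) (conjugate_symmetry \<sigma>)"
    using linear_symmetries_group[OF C] linear_symmetries_group[OF D] to_D
      conjugate_symmetry_compose[OF \<sigma>(1), of C _ C _ C]
    by (auto simp: group_hom_def group_hom_axioms_def hom_def linear_symmetries_iff)
  moreover have "\<exists>x\<in>carrier (linear_automorphisms C). \<exists>n\<in>natural_automorphisms D. y = n \<otimes>\<^bsub>linear_automorphisms D\<^esub> conjugate_symmetry \<sigma> x"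
    if "y \<in> carrier (linear_automorphisms D)" for y
  proof -
    have y: "y \<in> linear_symmetries D" using that by simp
    then have "y = identity_symmetry D \<otimes>\<^bsub>linear_automorphisms D\<^esub>
        conjugate_symmetry \<sigma> (conjugate_symmetry \<tau> y)"
      using compose_identity_symmetry(1)[of D y D] galois_conjugate_inverse(2)[of \<sigma> \<tau> y, OF \<sigma>\<tau>]
      by (simp add: linear_symmetries_iff del: compose_symmetry.simps)
    moreover have "conjugate_symmetry \<tau> y \<in> carrier (linear_automorphisms C)" using from_D[OF y] by simp
    ultimately show ?thesis using identity_natural[OF D] by (intro bexI)
  qed
  ultimately have "linear_automorphisms C Mod {s \<in> carrier (linear_automorphisms C). conjugate_symmetry \<sigma> s \<in> natural_automorphisms D} \<cong> linear_automorphisms D Mod natural_automorphisms D"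
    by (rule FactGroup_iso_preimage(1)[OF _ natural_isomorphisms_normal[OF D]])
  moreover have "{s \<in> carrier (linear_automorphisms C). conjugate_symmetry \<sigma> s \<in> natural_automorphisms D} = natural_automorphisms C"
  proof (intro equalityI subsetI)
    fix s assume "s \<in> {s \<in> carrier (linear_automorphisms C). conjugate_symmetry \<sigma> s \<in> natural_automorphisms D}"
    then have "conjugate_symmetry \<tau> (conjugate_symmetry \<sigma> s) \<in> natural_automorphisms (galois_conjugate \<tau> D)"
      using conjugate_natural_isomorphism[OF \<tau>, of "conjugate_symmetry \<sigma> s" D] by blast
    then show "s \<in> natural_automorphisms C"
      unfolding \<tau>D galois_conjugate_inverse(2)[of \<tau> \<sigma>, OF \<tau>\<sigma>] .
  next
    fix s assume "s \<in> natural_automorphisms C"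
    then show "s \<in> {s \<in> carrier (linear_automorphisms C). conjugate_symmetry \<sigma> s \<in> natural_automorphisms D}"
      using natural_isomorphisms_linear[OF C] conjugate_natural_isomorphism[OF \<sigma>(1), of s C]
      unfolding D_def symmetry_monoid_simps by blast
  qed
  ultimately show ?thesis by (simp add: linear_symmetry_group_def D_def)
qed

section \<open>Subfields of the complex numbers and their Galois groups\<close>

lemma normal_over_rationalsD:
  assumes "normal_over_rationals K"
  shows "1 \<in> K" "x \<in> K \<Longrightarrow> y \<in> K \<Longrightarrow> x - y \<in> K" "x \<in> K \<Longrightarrow> y \<in> K \<Longrightarrow> x / y \<in> K"
proof -
  have K: "subfield K complex_ring" using assms(1) by (simp add: normal_over_rationals_def)
  note ring = subringE[OF subfieldE(1)[OF K]]
  interpret R: field complex_ring by (rule field_from_type_algebra)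
  show 1: "1 \<in> K" using ring(3) by (simp add: ring_of_type_algebra_def)
  have minus: "- z \<in> K" if "z \<in> K" for z
  proof -
    have "\<ominus>\<^bsub>complex_ring\<^esub> z = - z"
      by (rule R.minus_equality) (simp_all add: ring_of_type_algebra_def)
    then show ?thesis using ring(5)[OF that] by simp
  qed
  have add: "z + w \<in> K" if "z \<in> K" "w \<in> K" for z w
    using ring(7)[OF that] by (simp add: ring_of_type_algebra_def)
  have mult: "z * w \<in> K" if "z \<in> K" "w \<in> K" for z w
    using ring(6)[OF that] by (simp add: ring_of_type_algebra_def)
  have inverse: "inverse z \<in> K" if "z \<in> K" for z
  proof (cases "z = 0")
    case False
    then have "z \<in> Units (complex_ring\<lparr>carrier := K\<rparr>)"
      using subfield.subfield_Units[OF K] that by (simp add: ring_of_type_algebra_def)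
    then obtain w where "w \<in> K" "z * w = 1"
      unfolding Units_def by (auto simp: ring_of_type_algebra_def)
    then show ?thesis by (metis inverse_unique)
  qed (use that in simp)
  show "x - y \<in> K" if "x \<in> K" "y \<in> K" using add[OF that(1) minus[OF that(2)]] by simp
  show "x / y \<in> K" if "x \<in> K" "y \<in> K"
    using mult[OF that(1) inverse[OF that(2)]] by (simp add: divide_inverse)
qed

text \<open>The closure conditions pass to intersections; the empty intersection is the whole
  complex field, which satisfies them as well.\<close>

lemma normal_closure_field:
  shows "1 \<in> normal_closure K"
    and "x \<in> normal_closure K \<Longrightarrow> y \<in> normal_closure K \<Longrightarrow> x - y \<in> normal_closure K"
    and "x \<in> normal_closure K \<Longrightarrow> y \<in> normal_closure K \<Longrightarrow> x / y \<in> normal_closure K"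
  by (auto simp: normal_closure_def normal_over_rationalsD)

text \<open>As \<open>q\<close> maps the normal closure onto itself, its graph has equal domain and
  range, which is what \<open>extend_subfield_automorphism\<close> demands.\<close>

lemma galois_group_extends:
  assumes q: "q \<in> galois_group (normal_closure K)"
  obtains \<sigma> where "field_hom \<sigma>" "bij \<sigma>" "\<And>x. x \<in> normal_closure K \<Longrightarrow> \<sigma> x = q x"
proof -
  let ?K = "normal_closure K"
  have bij: "bij_betw q ?K ?K" and hom: "q \<in> Ring.ring_hom (complex_ring\<lparr>carrier := ?K\<rparr>) (complex_ring\<lparr>carrier := ?K\<rparr>)"
    and rat: "\<And>x. x \<in> \<rat> \<Longrightarrow> q x = x"
    using q by (auto simp: galois_group_def ring_iso_def)
  have add: "q (x + y) = q x + q y" and mult: "q (x * y) = q x * q y" if "x \<in> ?K" "y \<in> ?K" for x y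
    using ring_hom_add[OF hom] ring_hom_mult[OF hom] that by (simp_all add: ring_of_type_algebra_def)
  note one = normal_closure_field(1)[of K]
  have q0: "q 0 = 0" and q1: "q 1 = 1" using rat by simp_all
  have zero: "0 \<in> ?K" using normal_closure_field(2)[OF one one] by simp
  have diff: "q (x - y) = q x - q y" if "x \<in> ?K" "y \<in> ?K" for x y
    using add[OF normal_closure_field(2)[OF that] that(2)] by simp
  have divide: "q (x / y) = q x / q y" if "x \<in> ?K" "y \<in> ?K" for x y
  proof (cases "y = 0")
    case False
    then have "q y \<noteq> 0" using bij that zero q0 by (metis bij_betw_def inj_on_def)
    then show ?thesis
      using mult[OF normal_closure_field(3)[OF that] that(2)] False by (simp add: field_simps)
  qed (simp add: q0)
  define G where "G = {(x, q x) | x. x \<in> ?K}"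
  have "q x = 0 \<longleftrightarrow> x = 0" if "x \<in> ?K" for x
    using bij that zero q0 by (metis bij_betw_def inj_on_def)
  then have pf: "partial_field_iso G"
    unfolding partial_field_iso_def G_def
    using one q1 normal_closure_field diff divide by auto
  have dr: "Domain G = Range G"
  proof -
    have "Domain G = ?K" "Range G = q ` ?K" by (auto simp: G_def)
    then show ?thesis using bij by (simp add: bij_betw_def)
  qed
  obtain \<sigma> :: "complex \<Rightarrow> complex" where \<sigma>: "bij \<sigma>" "\<And>x y. \<sigma> (x + y) = \<sigma> x + \<sigma> y"
    "\<And>x y. \<sigma> (x * y) = \<sigma> x * \<sigma> y" "\<And>x y. (x, y) \<in> G \<Longrightarrow> \<sigma> x = y"
    by (rule extend_subfield_automorphism[OF pf dr]) (rule that; assumption)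
  have eq: "\<sigma> x = q x" if "x \<in> ?K" for x using \<sigma>(4) that by (auto simp: G_def)
  have "field_hom \<sigma>"
    by unfold_locales (use \<sigma>(2,3) eq[OF zero] eq[OF one] q0 q1 in auto)
  then show ?thesis using that \<sigma>(1) eq by blast
qed

lemma symbol_entries_K_field: "symbol_entries C \<subseteq> K_field C"
  unfolding K_field_def normal_closure_def symbol_field_def
  using generate_field.incl[of _ "symbol_entries C" complex_ring] by blast

text \<open>Unitarity depends on the gauge and need not survive entrywise conjugation. The unitary
  gauges \<open>C'\<close> and \<open>D'\<close> are therefore chosen independently: they need be
  neither conjugate to each other nor defined over \<open>K_field C\<close>. They are linked through
  the linear groups of \<open>C\<close> and of its conjugate.\<close>

theorem corollary4p3:
  fixes C :: "('a::finite) mtc_data" and q :: "complex \<Rightarrow> complex"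
  assumes "mtc C"
    and "number_field_gauge C"
    and "q \<in> galois_group (K_field C)"
  shows "(\<forall>C' D'. gauge_equivalent C C' \<and> unitary_gauge C' \<and>
            gauge_equivalent (galois_conjugate q C) D' \<and> unitary_gauge D' \<longrightarrow>
            unitary_symmetry_group C' \<cong> unitary_symmetry_group D') \<and>
         linear_symmetry_group C \<cong> linear_symmetry_group (galois_conjugate q C)"
proof -
  let ?D = "galois_conjugate q C"
  have C: "R_shaped C" using assms(1) by (simp add: mtc_def braiding_def R_shaped_def)
  have D: "R_shaped ?D" by (rule R_shaped_galois_conjugate[OF C])
  obtain \<sigma> where \<sigma>: "field_hom \<sigma>" "bij \<sigma>" "\<And>x. x \<in> K_field C \<Longrightarrow> \<sigma> x = q x"
    using galois_group_extends assms(3) unfolding K_field_def by blast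
  \<comment> \<open>\<open>q\<close> and \<sigma> agree only on \<open>K_field C\<close>, so the two
    conjugates may differ in the junk values of \<open>Fsym\<close>. The entries of R are all
    meaningful, so the R matrices are equal.\<close>
  have "transports (galois_conjugate \<sigma> C) (identity_symmetry (galois_conjugate \<sigma> C)) ?D"
  proof (rule transports_identity[OF R_shaped_galois_conjugate[OF C]])
    have "map_mat q (Rsym C a b c) = map_mat \<sigma> (Rsym C a b c)" for a b c
    proof (rule eq_matI)
      fix i j assume "i < dim_row (map_mat \<sigma> (Rsym C a b c))" "j < dim_col (map_mat \<sigma> (Rsym C a b c))"
      moreover have "Rsym C a b c \<in> carrier_mat (fus C b a c) (fus C a b c)"
        using C by (simp add: R_shaped_def)
      ultimately have ij: "i < fus C b a c" "j < fus C a b c" "i < dim_row (Rsym C a b c)"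
        "j < dim_col (Rsym C a b c)" by auto
      then have "Rsym C a b c $$ (i, j) \<in> symbol_entries C" unfolding symbol_entries_def by blast
      then show "map_mat q (Rsym C a b c) $$ (i, j) = map_mat \<sigma> (Rsym C a b c) $$ (i, j)"
        using ij \<sigma>(3)[OF subsetD[OF symbol_entries_K_field]] by simp
    qed auto
    then show "Rsym ?D = Rsym (galois_conjugate \<sigma> C)" by (simp add: galois_conjugate_def)
  next
    fix a b c d i j
    assume "i \<in> left_index (galois_conjugate \<sigma> C) a b c d" "j \<in> right_index (galois_conjugate \<sigma> C) a b c d"
    then have "i \<in> left_index C a b c d" "j \<in> right_index C a b c d"
      by (simp_all add: left_index_def right_index_def galois_conjugate_def)
    then have "Fsym C a b c d i j \<in> symbol_entries C" unfolding symbol_entries_def by blast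
    then show "Fsym ?D a b c d i j = Fsym (galois_conjugate \<sigma> C) a b c d i j"
      using \<sigma>(3)[OF subsetD[OF symbol_entries_K_field]] by (simp add: galois_conjugate_def)
  qed (simp add: galois_conjugate_def)
  then have "linear_symmetry_group ?D \<cong> linear_symmetry_group (galois_conjugate \<sigma> C)"
    using linear_symmetry_group_transports R_shaped_galois_conjugate[OF C] by blast
  \<comment> \<open>Reversing an isomorphism requires the group axioms for its source.\<close>
  moreover have group: "group (linear_symmetry_group E)" if "R_shaped E" for E :: "'a mtc_data"
    unfolding linear_symmetry_group_def
    by (rule normal.factorgroup_is_group[OF natural_isomorphisms_normal[OF that]])
  ultimately have CD: "linear_symmetry_group C \<cong> linear_symmetry_group ?D"
    using linear_symmetry_group_automorphism[OF C \<sigma>(1,2)] group.iso_sym[OF group[OF D]] iso_trans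
    by blast
  have gauge: "unitary_symmetry_group E' \<cong> linear_symmetry_group E"
    if E: "gauge_equivalent E E'" "unitary_gauge E'" "R_shaped E" for E E' :: "'a mtc_data"
  proof -
    obtain \<Gamma> where "transports E (id, \<Gamma>) E'" using gauge_equivalent_transports[OF E(1)] .
    then show ?thesis
      using unitary_symmetry_group_iso(1) E linear_symmetry_group_transports R_shaped_transports iso_trans
      by blast
  qed
  have "unitary_symmetry_group C' \<cong> unitary_symmetry_group D'"
    if C': "gauge_equivalent C C'" "unitary_gauge C'" and D': "gauge_equivalent ?D D'" "unitary_gauge D'"
    for C' D'
  proof -
    obtain \<Gamma> where "transports ?D (id, \<Gamma>) D'" using gauge_equivalent_transports[OF D'(1)] .
    then have "R_shaped D'" using R_shaped_transports D by blast
    then have "group (unitary_symmetry_group D')"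
      using unitary_symmetry_group_iso(2) D'(2) by blast
    then have "linear_symmetry_group ?D \<cong> unitary_symmetry_group D'"
      using group.iso_sym gauge[OF D' D] by blast
    then show ?thesis using gauge[OF C' C] CD iso_trans by blast
  qed
  with CD show ?thesis by blast
qed

end
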